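(* Let $\mathcal{O}\subset\mathbb{R}^d$ be an open subset, $\Sigma\subseteq\partial\mathcal{O}$ relatively open, and $\mathfrak{K}\subset C^2(\mathcal{O})$ (respectively, $\mathfrak{K}\subset W^{2,d}_{\mathrm{loc}}(\mathcal{O})$) a convex cone containing the constant function $1$. Let $Au=-\operatorname{tr}(aD^2u)-\langle b,Du\rangle+cu$ have the weak maximum principle property on $\mathcal{O}\cup\Sigma$ for $\mathfrak{K}$. Suppose that $u,-v\in\mathfrak{K}$. 1. If $c\ge 0$ on $\mathcal{O}$ and $Au\le 0$ on $\mathcal{O}$, then $u\le 0\vee\sup_{\partial\mathcal{O}\setminus\Sigma}u^*$ on $\mathcal{O}$. 2. If $Au$ has arbitrary sign and there is a constant $c_0>0$ such that $c\ge c_0$ on $\mathcal{O}$, then $u\le 0\vee\frac{1}{c_0}\sup_{\mathcal{O}}Au\vee\sup_{\partial\mathcal{O}\setminus\Sigma}u^*$ on $\mathcal{O}$. 3. If $c\ge 0$ on $\mathcal{O}$ and $Av\ge 0$ on $\mathcal{O}$, then $v\ge 0\wedge\inf_{\partial\mathcal{O}\setminus\Sigma}v_*$ on $\mathcal{O}$. 4. If $Av$ has arbitrary sign and $c\ge c_0$ on $\mathcal{O}$ for a positive constant $c_0$, then $v\ge 0\wedge\frac{1}{c_0}\inf_{\mathcal{O}}Av\wedge\inf_{\partial\mathcal{O}\setminus\Sigma}v_*$ on $\mathcal{O}$. 5. If $c\ge 0$ on $\mathcal{O}$, $Au=0$ on $\mathcal{O}$, $u\in C(\mathcal{O}\cup(\partial\mathcal{O}\setminus\bar\Sigma))$,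 and $u\in\mathfrak{K}\cap-\mathfrak{K}$, then $\|u\|_{C(\bar{\mathcal{O}})}\le\|u\|_{C(\partial\mathcal{O}\setminus\Sigma)}$. 6. If $Au$ has arbitrary sign, $c\ge c_0$ on $\mathcal{O}$ for a positive constant $c_0$, $u\in C(\mathcal{O}\cup(\partial\mathcal{O}\setminus\bar\Sigma))$, and $u\in\mathfrak{K}\cap-\mathfrak{K}$, then $\|u\|_{C(\bar{\mathcal{O}})}\le\frac{1}{c_0}\|Au\|_{C(\bar{\mathcal{O}})}\vee\|u\|_{C(\partial\mathcal{O}\setminus\Sigma)}$. The terms $\sup_{\partial\mathcal{O}\setminus\Sigma}u^*$, $\inf_{\partial\mathcal{O}\setminus\Sigma}v_*$, and $\|u\|_{C(\partial\mathcal{O}\setminus\Sigma)}$ are omitted when $\Sigma=\partial\mathcal{O}$. When $\mathfrak{K}\subset W^{2,d}_{\mathrm{loc}}(\mathcal{O})$, the inequalities involving $c$ and $Au$ or $Av$ may hold a.e. on $\mathcal{O}$, and $\sup_{\mathcal{O}}Au$, $\inf_{\mathcal{O}}Av$, $\|Au\|_{C(\bar{\mathcal{O}})}$ are replaced by $\operatorname{ess\,sup}_{\mathcal{O}}Au$, $\operatorname{ess\,inf}_{\mathcal{O}}Av$, $\|Au\|_{L^\infty(\mathcal{O})}$.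
   Context: $a:\mathcal{O}\to\mathscr{S}^+(d)$ takes values in the non-negative definite symmetric real $d\times d$ matrices, $b:\mathcal{O}\to\mathbb{R}^d$, $c:\mathcal{O}\to\mathbb{R}$; coefficients are everywhere-defined when $\mathfrak{K}\subset C^2(\mathcal{O})$ and measurable when $\mathfrak{K}\subset W^{2,d}_{\mathrm{loc}}(\mathcal{O})$. $u^*$ and $u_*$ denote the upper and lower semicontinuous envelopes on $\bar{\mathcal{O}}$ of $u:\mathcal{O}\to\mathbb{R}$; $x\vee y=\max\{x,y\}$, $x\wedge y=\min\{x,y\}$. The norms $\|\cdot\|_{C(\cdot)}$ are supremum norms (possibly $+\infty$, with values of $u$ at boundary points where it is not continuous understood via its envelopes). Weak maximum principle property: $A$ obeys the weak maximum principle property on $\mathcal{O}\cup\Sigma$ for $\mathfrak{K}$ if whenever $u\in\mathfrak{K}$ obeys $Au\le 0$ (a.e.) on $\mathcal{O}$ and $u^*\le 0$ on $\partial\mathcal{O}\setminus\bar\Sigma$, then $u\le 0$ on $\mathcal{O}$.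
   Formalization: The convex cone K is assumed to contain the constant function -1 as well as 1; otherwise the claim fails, e.g. item 2 for O the real line, a=0, b=1-exp(-x), c=1, K={s+t exp(x): s,t>=0}, u=exp(x). *)

theory Defs
  imports "HOL-Analysis.Analysis" "HOL-Probability.Essential_Supremum"
begin

text \<open>
  Functions on an open set \<open>\<Omega>\<close> are total functions of type \<open>real ^ 'n \<Rightarrow> real\<close> whose values
  outside \<open>\<Omega>\<close> are irrelevant: all notions below depend only on the values in \<open>\<Omega>\<close>.
\<close>

section \<open>Classical derivatives\<close>

definition partial :: "'n \<Rightarrow> (real ^ 'n \<Rightarrow> real) \<Rightarrow> real ^ 'n \<Rightarrow> real" where
  "partial i f x = frechet_derivative f (at x) (axis i 1)"

definition C2 :: "(real ^ 'n) set \<Rightarrow> (real ^ 'n \<Rightarrow> real) set" where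
  "C2 \<Omega> = {u. (\<forall>x\<in>\<Omega>. u differentiable (at x)) \<and>
             (\<forall>i. \<forall>x\<in>\<Omega>. partial i u differentiable (at x)) \<and>
             (\<forall>i j. continuous_on \<Omega> (partial i (partial j u)))}"

definition gradient :: "(real ^ 'n \<Rightarrow> real) \<Rightarrow> real ^ 'n \<Rightarrow> real ^ 'n" where
  "gradient u x = (\<chi> i. partial i u x)"

definition hessian :: "(real ^ 'n \<Rightarrow> real) \<Rightarrow> real ^ 'n \<Rightarrow> real ^ 'n ^ 'n" where
  "hessian u x = (\<chi> i j. partial i (partial j u) x)"

section \<open>Weak derivatives and local Sobolev spaces\<close>

definition smooth :: "(real ^ 'n \<Rightarrow> real) \<Rightarrow> bool" where
  "smooth f \<longleftrightarrow> (\<forall>is x. foldr partial is f differentiable (at x))"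

definition test_fun :: "(real ^ 'n) set \<Rightarrow> (real ^ 'n \<Rightarrow> real) set" where
  "test_fun \<Omega> = {\<phi>. smooth \<phi> \<and> compact (closure {x. \<phi> x \<noteq> 0}) \<and> closure {x. \<phi> x \<noteq> 0} \<subseteq> \<Omega>}"

definition Lp_loc :: "nat \<Rightarrow> (real ^ 'n) set \<Rightarrow> (real ^ 'n \<Rightarrow> real) set" where
  "Lp_loc p \<Omega> = {f. f \<in> borel_measurable (lebesgue_on \<Omega>) \<and>
     (\<forall>K. compact K \<and> K \<subseteq> \<Omega> \<longrightarrow> (\<lambda>x. \<bar>f x\<bar> ^ p) absolutely_integrable_on K)}"

definition has_weak_partial ::
    "(real ^ 'n) set \<Rightarrow> 'n \<Rightarrow> (real ^ 'n \<Rightarrow> real) \<Rightarrow> (real ^ 'n \<Rightarrow> real) \<Rightarrow> bool" where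
  "has_weak_partial \<Omega> i u g \<longleftrightarrow> u \<in> Lp_loc 1 \<Omega> \<and> g \<in> Lp_loc 1 \<Omega> \<and>
     (\<forall>\<phi>\<in>test_fun \<Omega>.
        (LINT x:\<Omega>|lebesgue. u x * partial i \<phi> x) = - (LINT x:\<Omega>|lebesgue. g x * \<phi> x))"

text \<open>Weak partial derivatives are determined only up to null sets; a representative is chosen.\<close>

definition weak_partial ::
    "(real ^ 'n) set \<Rightarrow> 'n \<Rightarrow> (real ^ 'n \<Rightarrow> real) \<Rightarrow> real ^ 'n \<Rightarrow> real" where
  "weak_partial \<Omega> i u = (SOME g. has_weak_partial \<Omega> i u g)"

text \<open>
  \<open>W\<^sup>2\<^sup>,\<^sup>d\<close> is locally embedded in the continuous functions. Since the weak maximum principle makes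
  pointwise statements about \<open>u\<close>, an element of the local Sobolev space is represented
  by its continuous representative. The exponent \<open>d\<close> is the dimension \<open>CARD('n)\<close>.
\<close>

definition W2d_loc :: "(real ^ 'n) set \<Rightarrow> (real ^ 'n \<Rightarrow> real) set" where
  "W2d_loc \<Omega> = {u. continuous_on \<Omega> u \<and> u \<in> Lp_loc CARD('n) \<Omega> \<and>
     (\<forall>i. \<exists>g\<in>Lp_loc CARD('n) \<Omega>. has_weak_partial \<Omega> i u g) \<and>
     (\<forall>i j. \<exists>h\<in>Lp_loc CARD('n) \<Omega>. has_weak_partial \<Omega> i (weak_partial \<Omega> j u) h)}"

definition weak_gradient :: "(real ^ 'n) set \<Rightarrow> (real ^ 'n \<Rightarrow> real) \<Rightarrow> real ^ 'n \<Rightarrow> real ^ 'n" where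
  "weak_gradient \<Omega> u x = (\<chi> i. weak_partial \<Omega> i u x)"

definition weak_hessian :: "(real ^ 'n) set \<Rightarrow> (real ^ 'n \<Rightarrow> real) \<Rightarrow> real ^ 'n \<Rightarrow> real ^ 'n ^ 'n" where
  "weak_hessian \<Omega> u x = (\<chi> i j. weak_partial \<Omega> i (weak_partial \<Omega> j u) x)"

section \<open>The operator\<close>

definition nonneg_definite :: "real ^ 'n ^ 'n \<Rightarrow> bool" where
  "nonneg_definite M \<longleftrightarrow> transpose M = M \<and> (\<forall>\<xi>. 0 \<le> \<xi> \<bullet> (M *v \<xi>))"

definition classical_op ::
    "(real ^ 'n \<Rightarrow> real ^ 'n ^ 'n) \<Rightarrow> (real ^ 'n \<Rightarrow> real ^ 'n) \<Rightarrow> (real ^ 'n \<Rightarrow> real) \<Rightarrow>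
     (real ^ 'n \<Rightarrow> real) \<Rightarrow> real ^ 'n \<Rightarrow> real" where
  "classical_op a b c u x = - trace (a x ** hessian u x) - b x \<bullet> gradient u x + c x * u x"

definition weak_op ::
    "(real ^ 'n) set \<Rightarrow>
     (real ^ 'n \<Rightarrow> real ^ 'n ^ 'n) \<Rightarrow> (real ^ 'n \<Rightarrow> real ^ 'n) \<Rightarrow> (real ^ 'n \<Rightarrow> real) \<Rightarrow>
     (real ^ 'n \<Rightarrow> real) \<Rightarrow> real ^ 'n \<Rightarrow> real" where
  "weak_op \<Omega> a b c u x =
     - trace (a x ** weak_hessian \<Omega> u x) - b x \<bullet> weak_gradient \<Omega> u x + c x * u x"

section \<open>Semicontinuous envelopes and norms\<close>

text \<open>
  For \<open>x\<close> in the closure of \<open>\<Omega>\<close> these are the limsup and liminf of \<open>u y\<close> as \<open>y \<rightarrow> x\<close>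
  in \<open>\<Omega>\<close>, where \<open>y = x\<close> is allowed if \<open>x \<in> \<Omega>\<close>.
\<close>

definition usc_env :: "(real ^ 'n) set \<Rightarrow> (real ^ 'n \<Rightarrow> real) \<Rightarrow> real ^ 'n \<Rightarrow> ereal" where
  "usc_env \<Omega> u x = (INF r\<in>{0<..}. SUP y\<in>\<Omega> \<inter> ball x r. ereal (u y))"

definition lsc_env :: "(real ^ 'n) set \<Rightarrow> (real ^ 'n \<Rightarrow> real) \<Rightarrow> real ^ 'n \<Rightarrow> ereal" where
  "lsc_env \<Omega> u x = (SUP r\<in>{0<..}. INF y\<in>\<Omega> \<inter> ball x r. ereal (u y))"

text \<open>
  The supremum norm over \<open>S \<subseteq> closure \<Omega>\<close> of a function on \<open>\<Omega>\<close>. At a boundary point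
  where \<open>u\<close> has a continuous extension, both envelopes equal the extended value. The supremum
  over the empty set is \<open>0\<close> in type \<open>ennreal\<close>, so such a norm drops out of the estimates.
\<close>

definition sup_norm :: "(real ^ 'n) set \<Rightarrow> (real ^ 'n) set \<Rightarrow> (real ^ 'n \<Rightarrow> real) \<Rightarrow> ennreal" where
  "sup_norm \<Omega> S u = (SUP x\<in>S. if x \<in> \<Omega> then ennreal \<bar>u x\<bar>
     else max (e2ennreal \<bar>usc_env \<Omega> u x\<bar>) (e2ennreal \<bar>lsc_env \<Omega> u x\<bar>))"

definition ess_sup :: "(real ^ 'n) set \<Rightarrow> (real ^ 'n \<Rightarrow> real) \<Rightarrow> ereal" where
  "ess_sup \<Omega> f = esssup (lebesgue_on \<Omega>) (\<lambda>x. ereal (f x))"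

definition ess_inf :: "(real ^ 'n) set \<Rightarrow> (real ^ 'n \<Rightarrow> real) \<Rightarrow> ereal" where
  "ess_inf \<Omega> f = - esssup (lebesgue_on \<Omega>) (\<lambda>x. - ereal (f x))"

definition Linf_norm :: "(real ^ 'n) set \<Rightarrow> (real ^ 'n \<Rightarrow> real) \<Rightarrow> ennreal" where
  "Linf_norm \<Omega> f = esssup (lebesgue_on \<Omega>) (\<lambda>x. ennreal \<bar>f x\<bar>)"

text \<open>\<open>u \<in> C(\<Omega> \<union> S)\<close> for \<open>u\<close> defined on \<open>\<Omega>\<close> and a part \<open>S\<close> of its boundary.\<close>

definition extends_continuously ::
    "(real ^ 'n) set \<Rightarrow> (real ^ 'n) set \<Rightarrow> (real ^ 'n \<Rightarrow> real) \<Rightarrow> bool" where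
  "extends_continuously \<Omega> S u \<longleftrightarrow>
     (\<exists>f. continuous_on (\<Omega> \<union> S) f \<and> (\<forall>x\<in>\<Omega>. f x = u x))"

section \<open>The weak maximum principle property\<close>

text \<open>
  The library's \<open>convex_cone\<close>, written out because the function type is not an instance of
  \<open>real_vector\<close>. Such a cone containing the constant \<open>1\<close> need not contain negative constants,
  while the comparison functions \<open>u - M\<close> with constants \<open>M \<ge> 0\<close> have to lie in the cone. The
  estimates fail without this: on the real line take \<open>a = 0\<close>, \<open>b x = 1 - exp (- x)\<close>, \<open>c = 1\<close> and the
  cone of all \<open>s + t * exp x\<close> with \<open>s, t \<ge> 0\<close>. The operator maps this function to \<open>s + t\<close>, so the
  weak maximum principle property holds, but \<open>exp\<close> is not bounded by \<open>1\<close>. Hence both constants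
  \<open>1\<close> and \<open>-1\<close> are required to lie in the cone.
\<close>

definition fun_convex_cone :: "(real ^ 'n \<Rightarrow> real) set \<Rightarrow> bool" where
  "fun_convex_cone \<KK> \<longleftrightarrow> \<KK> \<noteq> {} \<and>
     (\<forall>f\<in>\<KK>. \<forall>g\<in>\<KK>. (\<lambda>x. f x + g x) \<in> \<KK>) \<and>
     (\<forall>f\<in>\<KK>. \<forall>t\<ge>0. (\<lambda>x. t * f x) \<in> \<KK>)"

definition weak_max_principle_C2 ::
    "(real ^ 'n \<Rightarrow> real ^ 'n ^ 'n) \<Rightarrow> (real ^ 'n \<Rightarrow> real ^ 'n) \<Rightarrow> (real ^ 'n \<Rightarrow> real) \<Rightarrow>
     (real ^ 'n) set \<Rightarrow> (real ^ 'n) set \<Rightarrow> (real ^ 'n \<Rightarrow> real) set \<Rightarrow> bool" where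
  "weak_max_principle_C2 a b c \<Omega> \<Sigma> \<KK> \<longleftrightarrow>
     (\<forall>u\<in>\<KK>. (\<forall>x\<in>\<Omega>. classical_op a b c u x \<le> 0) \<and>
        (\<forall>x\<in>frontier \<Omega> - closure \<Sigma>. usc_env \<Omega> u x \<le> 0) \<longrightarrow> (\<forall>x\<in>\<Omega>. u x \<le> 0))"

definition weak_max_principle_W2d ::
    "(real ^ 'n \<Rightarrow> real ^ 'n ^ 'n) \<Rightarrow> (real ^ 'n \<Rightarrow> real ^ 'n) \<Rightarrow> (real ^ 'n \<Rightarrow> real) \<Rightarrow>
     (real ^ 'n) set \<Rightarrow> (real ^ 'n) set \<Rightarrow> (real ^ 'n \<Rightarrow> real) set \<Rightarrow> bool" where
  "weak_max_principle_W2d a b c \<Omega> \<Sigma> \<KK> \<longleftrightarrow>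
     (\<forall>u\<in>\<KK>. (AE x in lebesgue_on \<Omega>. weak_op \<Omega> a b c u x \<le> 0) \<and>
        (\<forall>x\<in>frontier \<Omega> - closure \<Sigma>. usc_env \<Omega> u x \<le> 0) \<longrightarrow> (\<forall>x\<in>\<Omega>. u x \<le> 0))"

end

theory Submission
  imports Defs "HOL-Real_Asymp.Real_Asymp"
begin

text \<open>
  The estimates are comparisons of \<open>u\<close> with a constant. Let \<open>M\<close> be the claimed upper bound. It is
  nonnegative, and it may be assumed finite. Subtracting it changes \<open>A u\<close> into
  \<open>A (u - M) = A u - c M\<close>, which is nonpositive in each case: if \<open>A u \<le> 0 \<le> c\<close> because \<open>c M \<ge> 0\<close>,
  and if \<open>c \<ge> c0 > 0\<close> because \<open>A u \<le> sup (A u) \<le> c0 M \<le> c M\<close>. The upper envelope of \<open>u - M\<close> is nonpositive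
  on the boundary outside \<open>\<Sigma>\<close>, so the weak maximum principle gives \<open>u \<le> M\<close>. Applied to \<open>- v\<close>
  this yields the lower bounds, and applied to \<open>u\<close> and \<open>- u\<close> the bounds on the supremum norm;
  the locale \<open>weak_max_principle_operator\<close> carries this out, with \<open>le_bound\<close> as its core.

  The argument uses only \<open>A (u - M) = A u - c M\<close> and \<open>A (- u) = - A u\<close>. For functions of class \<open>C2\<close>
  both are immediate. In the Sobolev setting the operator is formed from arbitrarily chosen
  representatives of the weak derivatives. Subtracting a constant does not change the set of
  weak derivatives, because derivatives of test functions have integral \<open>0\<close>
  (\<open>integral_partial_test_fun\<close>), and so leaves the choice unchanged. Changing the sign may alter the
  choice, so uniqueness almost everywhere is needed. It follows from the fundamental lemma of
  the calculus of variations (\<open>AE_eq_0_if_integral_test_fun_eq_0\<close>): the indicator of a box is a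
  bounded limit of test functions, products of functions \<open>exp (- 1 / q)\<close> in the separate coordinates,
  and a locally integrable function whose integrals over all boxes vanish is zero almost everywhere.
\<close>

section \<open>Semicontinuous envelopes and comparison with constants\<close>

lemma ereal_le_abs: "e \<le> \<bar>e\<bar>" for e :: ereal
  by (cases e) auto

lemma usc_env_minus_const_le:
  assumes "usc_env \<Omega> u y \<le> ereal M"
  shows "usc_env \<Omega> (\<lambda>x. u x - M) y \<le> 0"
proof (rule ereal_le_epsilon2)
  fix e :: real
  assume "0 < e"
  then have "usc_env \<Omega> u y < ereal (M + e)"
    using assms by (auto intro: le_less_trans)
  then obtain r where r: "r > 0" "(SUP z\<in>\<Omega> \<inter> ball y r. ereal (u z)) < ereal (M + e)"
    by (auto simp: usc_env_def INF_less_iff)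
  have "(SUP z\<in>\<Omega> \<inter> ball y r. ereal (u z - M)) \<le> ereal e"
  proof (rule SUP_least)
    fix z
    assume "z \<in> \<Omega> \<inter> ball y r"
    then have "ereal (u z) < ereal (M + e)"
      using r(2) by (meson SUP_upper le_less_trans)
    then show "ereal (u z - M) \<le> ereal e" by simp
  qed
  then show "usc_env \<Omega> (\<lambda>x. u x - M) y \<le> 0 + ereal e"
    unfolding usc_env_def using r(1) by (auto intro: INF_lower2)
qed

text \<open>
  This symmetry turns every upper estimate for \<open>- v\<close> into a lower estimate for \<open>v\<close>.
\<close>

lemma usc_env_uminus: "usc_env \<Omega> (\<lambda>x. - u x) y = - lsc_env \<Omega> u y"
  by (simp add: usc_env_def lsc_env_def ereal_SUP_uminus_eq ereal_INF_uminus_eq flip: uminus_ereal.simps)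

text \<open>
  At a point of the closure every ball meets \<open>\<Omega>\<close>, so the supremum over it is at least one
  value \<open>u z \<ge> - B\<close>; away from the closure the upper envelope would be \<open>-\<infinity>\<close>.
\<close>

lemma abs_envelopes_le:
  assumes y: "y \<in> closure \<Omega>" and bound: "\<And>x. x \<in> \<Omega> \<Longrightarrow> \<bar>ereal (u x)\<bar> \<le> B"
  shows "\<bar>usc_env \<Omega> u y\<bar> \<le> B" and "\<bar>lsc_env \<Omega> u y\<bar> \<le> B"
proof -
  have upper: "usc_env \<Omega> w y \<le> B" and lower: "- B \<le> usc_env \<Omega> w y"
    if w: "\<And>x. x \<in> \<Omega> \<Longrightarrow> \<bar>ereal (w x)\<bar> \<le> B" for w
  proof -
    have "(SUP z\<in>\<Omega> \<inter> ball y 1. ereal (w z)) \<le> B"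
      using w by (intro SUP_least) (auto intro: order_trans[OF ereal_le_abs])
    then show "usc_env \<Omega> w y \<le> B"
      unfolding usc_env_def by (intro INF_lower2[where i = 1]) auto
    show "- B \<le> usc_env \<Omega> w y"
      unfolding usc_env_def
    proof (rule INF_greatest)
      fix r :: real
      assume "r \<in> {0<..}"
      then obtain z where z: "z \<in> \<Omega>" "z \<in> ball y r"
        using y by (auto simp: closure_approachable dist_commute)
      have "- B \<le> - \<bar>ereal (w z)\<bar>"
        using w[OF z(1)] by (simp only: ereal_minus_le_minus)
      also have "\<dots> \<le> ereal (w z)" by simp
      finally show "- B \<le> (SUP z\<in>\<Omega> \<inter> ball y r. ereal (w z))"
        using z by (auto intro: SUP_upper2)
    qed
  qed
  have w: "\<And>x. x \<in> \<Omega> \<Longrightarrow> \<bar>ereal (- u x)\<bar> \<le> B" using bound by simp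
  show "\<bar>usc_env \<Omega> u y\<bar> \<le> B"
    using upper[of u] lower[of u] bound by (auto intro!: ereal_abs_leI simp: ereal_uminus_le_reorder)
  show "\<bar>lsc_env \<Omega> u y\<bar> \<le> B"
    using upper[OF w] lower[OF w] unfolding usc_env_uminus
    by (auto intro!: ereal_abs_leI)
qed

text \<open>
  The envelopes cannot exceed a bound on the values, so an estimate of \<open>\<bar>u\<bar>\<close> inside \<open>\<Omega>\<close> is
  already an estimate of the norm over the closure.
\<close>

lemma sup_norm_closure_le:
  assumes "\<And>x. x \<in> \<Omega> \<Longrightarrow> ennreal \<bar>u x\<bar> \<le> N"
  shows "sup_norm \<Omega> (closure \<Omega>) u \<le> N"
proof -
  have bound: "\<bar>ereal (u x)\<bar> \<le> enn2ereal N" if "x \<in> \<Omega>" for x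
    using assms[OF that] by (simp add: less_eq_ennreal.rep_eq)
  have e: "e2ennreal \<bar>e\<bar> \<le> N" if "\<bar>e\<bar> \<le> enn2ereal N" for e
    using e2ennreal_mono[OF that] by simp
  show ?thesis
    unfolding sup_norm_def
    using assms abs_envelopes_le[OF _ bound] by (intro SUP_least) (auto intro!: e)
qed

lemma usc_env_le_sup_norm:
  assumes "y \<in> S" "y \<notin> \<Omega>"
  shows "usc_env \<Omega> u y \<le> enn2ereal (sup_norm \<Omega> S u)"
    and "usc_env \<Omega> (\<lambda>x. - u x) y \<le> enn2ereal (sup_norm \<Omega> S u)"
proof -
  have le: "max (e2ennreal \<bar>usc_env \<Omega> u y\<bar>) (e2ennreal \<bar>lsc_env \<Omega> u y\<bar>) \<le> sup_norm \<Omega> S u"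
    unfolding sup_norm_def using assms by (intro SUP_upper2[of y]) auto
  have "\<bar>e\<bar> \<le> enn2ereal N" if "e2ennreal \<bar>e\<bar> \<le> N" for e N
    using that by (simp add: less_eq_ennreal.rep_eq enn2ereal_e2ennreal)
  then have "\<bar>usc_env \<Omega> u y\<bar> \<le> enn2ereal (sup_norm \<Omega> S u)"
    and "\<bar>lsc_env \<Omega> u y\<bar> \<le> enn2ereal (sup_norm \<Omega> S u)"
    using le by auto
  then show "usc_env \<Omega> u y \<le> enn2ereal (sup_norm \<Omega> S u)"
    and "usc_env \<Omega> (\<lambda>x. - u x) y \<le> enn2ereal (sup_norm \<Omega> S u)"
    unfolding usc_env_uminus
    by (metis ereal_le_abs order_trans, metis ereal_le_abs abs_ereal_uminus order_trans)
qed

text \<open>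
  The classical and the Sobolev setting differ only in the meaning of ``on \<open>\<Omega>\<close>'': everywhere, or
  almost everywhere. Both are instances of a filter \<open>F\<close>, the principal filter of \<open>\<Omega>\<close> or the filter
  of sets of full measure. Of the operator the estimates use
  its behaviour under subtraction of a constant and under change of sign. The sign rule asks that \<open>- u\<close>, and
  not \<open>u\<close>, be in the cone, because supersolutions \<open>v\<close> are only given with \<open>- v\<close> in it.
\<close>

locale weak_max_principle_operator =
  fixes \<Omega> \<Sigma> :: "(real ^ 'n) set" and \<KK> :: "(real ^ 'n \<Rightarrow> real) set"
    and L :: "(real ^ 'n \<Rightarrow> real) \<Rightarrow> real ^ 'n \<Rightarrow> real" and c :: "real ^ 'n \<Rightarrow> real"
    and F :: "(real ^ 'n) filter"
  assumes open_domain: "open \<Omega>"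
    and minus_const_mem: "u \<in> \<KK> \<Longrightarrow> 0 \<le> M \<Longrightarrow> (\<lambda>x. u x - M) \<in> \<KK>"
    and op_minus_const:
      "u \<in> \<KK> \<Longrightarrow> 0 \<le> M \<Longrightarrow> \<forall>\<^sub>F x in F. L (\<lambda>x. u x - M) x = L u x - c x * M"
    and op_uminus: "(\<lambda>x. - u x) \<in> \<KK> \<Longrightarrow> \<forall>\<^sub>F x in F. L (\<lambda>x. - u x) x = - L u x"
    and max_principle:
      "u \<in> \<KK> \<Longrightarrow> \<forall>\<^sub>F x in F. L u x \<le> 0 \<Longrightarrow>
       \<forall>x\<in>frontier \<Omega> - closure \<Sigma>. usc_env \<Omega> u x \<le> 0 \<Longrightarrow> x \<in> \<Omega> \<Longrightarrow> u x \<le> 0"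
begin

text \<open>
  The comparison argument behind all six estimates. If the bound is a finite \<open>M\<close>, then
  \<open>w = u - M\<close> lies in the cone, satisfies \<open>L w = L u - c M \<le> 0\<close> and is nonpositive at the part of
  the boundary seen by the maximum principle, so \<open>w \<le> 0\<close>. An infinite bound is trivial,
  and \<open>- \<infinity>\<close> is excluded because the bound is nonnegative.
\<close>

lemma le_bound:
  assumes u: "u \<in> \<KK>" and x: "x \<in> \<Omega>" and B: "0 \<le> B"
    and bdry: "\<And>y. y \<in> frontier \<Omega> - \<Sigma> \<Longrightarrow> usc_env \<Omega> u y \<le> B"
    and op: "\<And>M. 0 \<le> M \<Longrightarrow> B = ereal M \<Longrightarrow> \<forall>\<^sub>F x in F. L u x \<le> c x * M"
  shows "ereal (u x) \<le> B"
proof (cases B)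
  case (real M)
  then have M: "0 \<le> M" using B by simp
  have "u x - M \<le> 0"
  proof (rule max_principle[OF minus_const_mem[OF u M] _ _ x])
    show "\<forall>\<^sub>F x in F. L (\<lambda>x. u x - M) x \<le> 0"
      using op_minus_const[OF u M] op[OF M real] by eventually_elim simp
    show "\<forall>y\<in>frontier \<Omega> - closure \<Sigma>. usc_env \<Omega> (\<lambda>x. u x - M) y \<le> 0"
      using bdry real closure_subset[of \<Sigma>] by (auto intro!: usc_env_minus_const_le)
  qed
  then show ?thesis using real by simp
qed (use B in auto)

lemma subsolution_le:
  assumes u: "u \<in> \<KK>" and c: "\<forall>\<^sub>F x in F. 0 \<le> c x" and Lu: "\<forall>\<^sub>F x in F. L u x \<le> 0"
  shows "\<forall>x\<in>\<Omega>. ereal (u x) \<le> max 0 (SUP y\<in>frontier \<Omega> - \<Sigma>. usc_env \<Omega> u y)"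
proof
  fix x
  assume x: "x \<in> \<Omega>"
  show "ereal (u x) \<le> max 0 (SUP y\<in>frontier \<Omega> - \<Sigma>. usc_env \<Omega> u y)"
  proof (rule le_bound[OF u x])
    fix M :: real
    assume M: "0 \<le> M"
    show "\<forall>\<^sub>F x in F. L u x \<le> c x * M"
      using c Lu by eventually_elim (use M in \<open>auto intro: order_trans\<close>)
  qed (auto intro: SUP_upper2 simp: le_max_iff_disj)
qed

text \<open>
  If the right-hand side is a finite \<open>M\<close>, then \<open>S \<le> c0 * M\<close>, so \<open>L u \<le> c0 * M \<le> c * M\<close>; this is
  where a positive lower bound of \<open>c\<close> is used.
\<close>

lemma subsolution_le_pos:
  assumes u: "u \<in> \<KK>" and c0: "0 < c0" and c: "\<forall>\<^sub>F x in F. c0 \<le> c x"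
    and S: "\<forall>\<^sub>F x in F. ereal (L u x) \<le> S"
  shows "\<forall>x\<in>\<Omega>. ereal (u x) \<le>
    max 0 (max (ereal (1 / c0) * S) (SUP y\<in>frontier \<Omega> - \<Sigma>. usc_env \<Omega> u y))"
    (is "\<forall>x\<in>\<Omega>. _ \<le> ?B")
proof
  fix x
  assume x: "x \<in> \<Omega>"
  show "ereal (u x) \<le> ?B"
  proof (rule le_bound[OF u x])
    fix M :: real
    assume M: "0 \<le> M" "?B = ereal M"
    then have "ereal (1 / c0) * S \<le> ereal M"
      by (metis max.cobounded1 max.cobounded2 order_trans)
    then have S_le: "S \<le> ereal (c0 * M)"
      using c0 by (cases S) (auto simp: field_simps)
    show "\<forall>\<^sub>F x in F. L u x \<le> c x * M"
      using S c
    proof eventually_elim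
      case (elim x)
      have "ereal (L u x) \<le> ereal (c0 * M)"
        using elim(1) S_le by (rule order_trans)
      then show ?case
        using elim(2) M(1) by (simp, meson mult_right_mono order_trans)
    qed
  qed (auto intro: SUP_upper2 simp: le_max_iff_disj)
qed

lemma supersolution_ge:
  assumes v: "(\<lambda>x. - v x) \<in> \<KK>" and c: "\<forall>\<^sub>F x in F. 0 \<le> c x" and Lv: "\<forall>\<^sub>F x in F. 0 \<le> L v x"
  shows "\<forall>x\<in>\<Omega>. ereal (v x) \<ge> min 0 (INF y\<in>frontier \<Omega> - \<Sigma>. lsc_env \<Omega> v y)"
proof
  fix x
  assume x: "x \<in> \<Omega>"
  have "\<forall>\<^sub>F x in F. L (\<lambda>x. - v x) x \<le> 0"
    using op_uminus[OF v] Lv by eventually_elim simp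
  from subsolution_le[OF v c this] x
  have "ereal (- v x) \<le> max 0 (- (INF y\<in>frontier \<Omega> - \<Sigma>. lsc_env \<Omega> v y))"
    by (simp add: usc_env_uminus ereal_SUP_uminus_eq)
  then show "ereal (v x) \<ge> min 0 (INF y\<in>frontier \<Omega> - \<Sigma>. lsc_env \<Omega> v y)"
    by (auto simp: le_max_iff_disj min_le_iff_disj ereal_uminus_le_reorder simp flip: uminus_ereal.simps)
qed

lemma supersolution_ge_pos:
  assumes v: "(\<lambda>x. - v x) \<in> \<KK>" and c0: "0 < c0" and c: "\<forall>\<^sub>F x in F. c0 \<le> c x"
    and I: "\<forall>\<^sub>F x in F. I \<le> ereal (L v x)"
  shows "\<forall>x\<in>\<Omega>. ereal (v x) \<ge>
    min 0 (min (ereal (1 / c0) * I) (INF y\<in>frontier \<Omega> - \<Sigma>. lsc_env \<Omega> v y))"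
proof
  fix x
  assume x: "x \<in> \<Omega>"
  have "\<forall>\<^sub>F x in F. ereal (L (\<lambda>x. - v x) x) \<le> - I"
    using op_uminus[OF v] I
    by eventually_elim (simp add: ereal_uminus_le_reorder flip: uminus_ereal.simps)
  from subsolution_le_pos[OF v c0 c this] x
  have "ereal (- v x) \<le>
    max 0 (max (- (ereal (1 / c0) * I)) (- (INF y\<in>frontier \<Omega> - \<Sigma>. lsc_env \<Omega> v y)))"
    by (simp add: usc_env_uminus ereal_SUP_uminus_eq)
  then show "ereal (v x) \<ge>
    min 0 (min (ereal (1 / c0) * I) (INF y\<in>frontier \<Omega> - \<Sigma>. lsc_env \<Omega> v y))"
    by (auto simp: le_max_iff_disj min_le_iff_disj ereal_uminus_le_reorder simp flip: uminus_ereal.simps)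
qed

text \<open>
  The comparison argument is applied to \<open>u\<close> and to \<open>- u\<close>. The norm over the boundary controls
  both envelopes there, hence the upper envelopes of both functions.
\<close>

lemma sup_norm_le:
  assumes u: "u \<in> \<KK>" "(\<lambda>x. - u x) \<in> \<KK>" and N: "sup_norm \<Omega> (frontier \<Omega> - \<Sigma>) u \<le> N"
    and op: "\<And>M. 0 \<le> M \<Longrightarrow> N = ennreal M \<Longrightarrow> \<forall>\<^sub>F x in F. \<bar>L u x\<bar> \<le> c x * M"
  shows "sup_norm \<Omega> (closure \<Omega>) u \<le> N"
proof (rule sup_norm_closure_le)
  fix x
  assume x: "x \<in> \<Omega>"
  have bdry: "usc_env \<Omega> u y \<le> enn2ereal N" "usc_env \<Omega> (\<lambda>x. - u x) y \<le> enn2ereal N"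
    if y: "y \<in> frontier \<Omega> - \<Sigma>" for y
  proof -
    have "y \<notin> \<Omega>" using y open_domain by (auto simp: frontier_def interior_open)
    then show "usc_env \<Omega> u y \<le> enn2ereal N" "usc_env \<Omega> (\<lambda>x. - u x) y \<le> enn2ereal N"
      using usc_env_le_sup_norm[OF y, of \<Omega> u] N
      by (auto simp: less_eq_ennreal.rep_eq intro: order_trans)
  qed
  have N_eq: "N = ennreal M" if "enn2ereal N = ereal M" for M
    using that by (metis e2ennreal_enn2ereal e2ennreal_ereal)
  have "ereal (u x) \<le> enn2ereal N"
  proof (rule le_bound[OF u(1) x _ bdry(1)])
    fix M :: real
    assume "0 \<le> M" "enn2ereal N = ereal M"
    from op[OF this(1) N_eq[OF this(2)]] show "\<forall>\<^sub>F x in F. L u x \<le> c x * M"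
      by eventually_elim simp
  qed auto
  moreover have "ereal (- u x) \<le> enn2ereal N"
  proof (rule le_bound[OF u(2) x _ bdry(2)])
    fix M :: real
    assume "0 \<le> M" "enn2ereal N = ereal M"
    from op[OF this(1) N_eq[OF this(2)]] op_uminus[OF u(2)]
    show "\<forall>\<^sub>F x in F. L (\<lambda>x. - u x) x \<le> c x * M"
      by eventually_elim simp
  qed auto
  ultimately show "ennreal \<bar>u x\<bar> \<le> N"
    by (auto simp: less_eq_ennreal.rep_eq abs_if)
qed

lemma solution_sup_norm_le:
  assumes u: "u \<in> \<KK>" "(\<lambda>x. - u x) \<in> \<KK>"
    and c: "\<forall>\<^sub>F x in F. 0 \<le> c x" and Lu: "\<forall>\<^sub>F x in F. L u x = 0"
  shows "sup_norm \<Omega> (closure \<Omega>) u \<le> sup_norm \<Omega> (frontier \<Omega> - \<Sigma>) u"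
proof (rule sup_norm_le[OF u order_refl])
  fix M :: real
  assume "0 \<le> M"
  with c Lu show "\<forall>\<^sub>F x in F. \<bar>L u x\<bar> \<le> c x * M"
    by (auto elim: eventually_elim2)
qed

lemma sup_norm_le_pos:
  assumes u: "u \<in> \<KK>" "(\<lambda>x. - u x) \<in> \<KK>"
    and c0: "0 < c0" and c: "\<forall>\<^sub>F x in F. c0 \<le> c x"
    and N: "\<forall>\<^sub>F x in F. ennreal \<bar>L u x\<bar> \<le> N"
  shows "sup_norm \<Omega> (closure \<Omega>) u \<le>
    max (ennreal (1 / c0) * N) (sup_norm \<Omega> (frontier \<Omega> - \<Sigma>) u)" (is "_ \<le> ?B")
proof (rule sup_norm_le[OF u])
  fix M :: real
  assume M: "0 \<le> M" "?B = ennreal M"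
  then have "ennreal (1 / c0) * N \<le> ennreal M" by (metis max.cobounded1)
  then have "ennreal c0 * (ennreal (1 / c0) * N) \<le> ennreal c0 * ennreal M"
    by (rule mult_left_mono) simp
  moreover have "ennreal c0 * (ennreal (1 / c0) * N) = N"
    using c0 by (simp add: mult.assoc[symmetric] ennreal_mult[symmetric])
  ultimately have N_le: "N \<le> ennreal (c0 * M)"
    using c0 M(1) by (simp add: ennreal_mult)
  show "\<forall>\<^sub>F x in F. \<bar>L u x\<bar> \<le> c x * M"
    using N c
  proof eventually_elim
    case (elim x)
    have "ennreal \<bar>L u x\<bar> \<le> ennreal (c0 * M)"
      using elim(1) N_le by (rule order_trans)
    then have "\<bar>L u x\<bar> \<le> c0 * M" using c0 M(1) by simp
    then show ?case
      using elim(2) M(1) by (meson mult_right_mono order_trans)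
  qed
qed simp

end

section \<open>The classical operator\<close>

text \<open>
  The two functions have the same Frechet derivatives, so the chosen derivative is the same
  even at points where neither is differentiable.
\<close>

lemma partial_minus_const: "partial i (\<lambda>x. u x - M) = partial i u"
proof -
  have "((\<lambda>x. u x - M) has_derivative D) F \<longleftrightarrow> (u has_derivative D) F" for D F
    using has_derivative_diff[of "\<lambda>x. u x - M" D F "\<lambda>x. - M" "\<lambda>x. 0"]
      has_derivative_diff[of u D F "\<lambda>x. M" "\<lambda>x. 0"] by auto
  then show ?thesis
    by (simp add: partial_def frechet_derivative_def fun_eq_iff)
qed

lemma partial_uminus:
  assumes "u differentiable at x"
  shows "partial i (\<lambda>x. - u x) x = - partial i u x"
  using frechet_derivative_at[OF has_derivative_minus[OF assms[unfolded frechet_derivative_works]]]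
  by (metis partial_def)

text \<open>
  Second derivatives need this: the sign rule for first derivatives is known only inside \<open>\<Omega>\<close>,
  and it has to be differentiated once more.
\<close>

lemma partial_cong_open:
  assumes "open \<Omega>" "x \<in> \<Omega>" "\<And>y. y \<in> \<Omega> \<Longrightarrow> u y = w y"
  shows "partial i u x = partial i w x"
proof -
  have "(u has_derivative D) (at x) \<longleftrightarrow> (w has_derivative D) (at x)" for D
    using has_derivative_transform_within_open[of u D x UNIV \<Omega> w]
      has_derivative_transform_within_open[of w D x UNIV \<Omega> u] assms by auto
  then show ?thesis
    by (simp add: partial_def frechet_derivative_def)
qed

lemma classical_op_minus_const:
  "classical_op a b c (\<lambda>x. u x - M) x = classical_op a b c u x - c x * M"
  by (simp add: classical_op_def hessian_def gradient_def partial_minus_const right_diff_distrib)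

lemma trace_matrix_mult_uminus: "trace (A ** (- H)) = - trace (A ** H)"
  for A H :: "real ^ 'n ^ 'n"
  by (simp add: trace_def matrix_matrix_mult_def sum_negf)

lemma classical_op_uminus:
  assumes "open \<Omega>" "(\<lambda>x. - u x) \<in> C2 \<Omega>" "x \<in> \<Omega>"
  shows "classical_op a b c (\<lambda>x. - u x) x = - classical_op a b c u x"
proof -
  define w where "w = (\<lambda>x. - u x)"
  have u: "u = (\<lambda>x. - w x)" by (simp add: w_def)
  have w: "w \<in> C2 \<Omega>" using assms(2) by (simp add: w_def)
  have 1: "partial j u y = - partial j w y" if "y \<in> \<Omega>" for j y
    unfolding u using w that by (auto intro!: partial_uminus simp: C2_def)
  have 2: "partial i (partial j u) x = - partial i (partial j w) x" for i j
  proof -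
    have "partial i (partial j u) x = partial i (\<lambda>y. - partial j w y) x"
      using assms(1,3) 1 by (rule partial_cong_open)
    also have "\<dots> = - partial i (partial j w) x"
      using w assms(3) by (auto intro!: partial_uminus simp: C2_def)
    finally show ?thesis .
  qed
  have "gradient u x = - gradient w x" "hessian u x = - hessian w x"
    using 1[OF assms(3)] 2 by (simp_all add: gradient_def hessian_def vec_eq_iff)
  then have "classical_op a b c u x = - classical_op a b c w x"
    by (simp add: classical_op_def trace_matrix_mult_uminus w_def)
  then show ?thesis by (simp add: w_def)
qed

section \<open>Smooth functions with compact support\<close>

lemma exp_ge_power_div_fact: "0 \<le> y \<Longrightarrow> y ^ n / fact n \<le> exp y" for y :: real
proof -
  assume y: "0 \<le> y"
  have "(\<Sum>k\<in>{n}. y ^ k /\<^sub>R fact k) \<le> (\<Sum>k. y ^ k /\<^sub>R fact k)"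
    using y by (intro sum_le_suminf summable_exp_generic) auto
  then show ?thesis by (simp add: exp_def divide_inverse mult.commute)
qed

text \<open>
  The classical flat function \<open>exp (- 1 / q)\<close>, cut off where \<open>q \<le> 0\<close>. The factor \<open>p / q ^ m\<close> makes
  the family, for fixed \<open>q\<close>, closed under differentiation, which is all that smoothness needs.
\<close>

definition bump :: "real poly \<Rightarrow> real poly \<Rightarrow> nat \<Rightarrow> real \<Rightarrow> real" where
  "bump q p m t = (if 0 < poly q t then poly p t / poly q t ^ m * exp (- 1 / poly q t) else 0)"

text \<open>
  The exponential beats every power of \<open>1 / q\<close>: with \<open>y = 1 / q\<close> and \<open>n = m + 2\<close> one has
  \<open>y ^ n * exp (- y) \<le> fact n\<close>. The two extra powers leave quadratic decay in \<open>q\<close>, hence a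
  vanishing derivative at the edge of the support.
\<close>

lemma abs_bump_le: "\<bar>bump q p m t\<bar> \<le> \<bar>poly p t\<bar> * fact (m + 2) * (max 0 (poly q t))\<^sup>2"
proof (cases "0 < poly q t")
  case True
  define s where "s = poly q t"
  have s: "0 < s" using True by (simp add: s_def)
  have "(1 / s) ^ (m + 2) / fact (m + 2) \<le> exp (1 / s)"
    using s by (intro exp_ge_power_div_fact) simp
  then have "(1 / s) ^ (m + 2) * exp (- (1 / s)) \<le> fact (m + 2)"
    by (simp add: exp_minus pos_divide_le_eq mult.commute inverse_eq_divide
        del: fact_Suc add_2_eq_Suc' power_Suc)
  then have "(1 / s) ^ (m + 2) * exp (- (1 / s)) * s\<^sup>2 \<le> fact (m + 2) * s\<^sup>2"
    by (rule mult_right_mono) simp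
  moreover have "(1 / s) ^ (m + 2) * exp (- (1 / s)) * s\<^sup>2 = exp (- (1 / s)) / s ^ m"
    using s by (simp add: field_simps power_add power2_eq_square)
  ultimately have "\<bar>poly p t\<bar> * (exp (- (1 / s)) / s ^ m) \<le> \<bar>poly p t\<bar> * (fact (m + 2) * s\<^sup>2)"
    by (intro mult_left_mono) auto
  then show ?thesis
    using s by (simp add: bump_def s_def[symmetric] abs_mult max_def)
qed (simp add: bump_def)

text \<open>
  Where \<open>q\<close> is positive this is the product and chain rule. At a point \<open>t\<close> with \<open>q t \<le> 0\<close> the
  positive part of \<open>q s\<close> is at most \<open>\<bar>q s - q t\<bar>\<close>, so the quadratic bound makes the difference
  quotient tend to \<open>0\<close>, whether \<open>t\<close> is on the edge of the support or beyond it.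
\<close>

lemma bump_has_derivative:
  "(bump q p m has_real_derivative
     bump q (pderiv p * q\<^sup>2 - smult (of_nat m) (p * q * pderiv q) + p * pderiv q) (m + 2) t) (at t)"
proof (cases "0 < poly q t")
  case True
  define U where "U = {s. 0 < poly q s}"
  have U: "open U" "t \<in> U"
    unfolding U_def using True by (auto intro!: open_Collect_less continuous_intros)
  have "((\<lambda>s. poly p s / poly q s ^ m * exp (- 1 / poly q s)) has_real_derivative
     bump q (pderiv p * q\<^sup>2 - smult (of_nat m) (p * q * pderiv q) + p * pderiv q) (m + 2) t) (at t)"
    using True
    apply (auto simp: bump_def intro!: derivative_eq_intros)
    apply (cases m)
    apply (simp_all add: field_simps power2_eq_square)
    done
  then show ?thesis
    by (rule has_field_derivative_transform_within_open[OF _ U]) (simp add: bump_def U_def)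
next
  case False
  \<comment> \<open>The difference quotient of \<open>q\<close>, which stays bounded near \<open>t\<close>.\<close>
  define Q where "Q s = (poly q s - poly q t) / (s - t)" for s
  have Q: "(Q \<longlongrightarrow> poly (pderiv q) t) (at t)"
    using poly_DERIV[of q t] by (simp add: has_field_derivative_iff Q_def[abs_def])
  have "((\<lambda>s. (bump q p m s - bump q p m t) / (s - t)) \<longlongrightarrow> 0) (at t)"
  proof (rule Lim_null_comparison)
    have "((\<lambda>s. \<bar>poly p s\<bar> * fact (m + 2) * \<bar>Q s\<bar> * \<bar>poly q s - poly q t\<bar>) \<longlongrightarrow>
       \<bar>poly p t\<bar> * fact (m + 2) * \<bar>poly (pderiv q) t\<bar> * \<bar>poly q t - poly q t\<bar>) (at t)"
      by (intro tendsto_intros Q isContD poly_isCont)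
    then show "((\<lambda>s. \<bar>poly p s\<bar> * fact (m + 2) * \<bar>Q s\<bar> * \<bar>poly q s - poly q t\<bar>) \<longlongrightarrow> 0) (at t)"
      by simp
    show "\<forall>\<^sub>F s in at t. norm ((bump q p m s - bump q p m t) / (s - t))
        \<le> \<bar>poly p s\<bar> * fact (m + 2) * \<bar>Q s\<bar> * \<bar>poly q s - poly q t\<bar>"
    proof (rule eventually_at_filter[THEN iffD2], rule always_eventually, intro allI impI)
      fix s
      assume s: "s \<noteq> t"
      have "(max 0 (poly q s))\<^sup>2 \<le> \<bar>poly q s - poly q t\<bar>\<^sup>2"
        using False by (intro power_mono) auto
      then have "\<bar>bump q p m s\<bar> \<le> \<bar>poly p s\<bar> * fact (m + 2) * \<bar>poly q s - poly q t\<bar>\<^sup>2"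
        by (intro order_trans[OF abs_bump_le] mult_left_mono) auto
      then have "\<bar>bump q p m s\<bar> / \<bar>s - t\<bar>
          \<le> \<bar>poly p s\<bar> * fact (m + 2) * \<bar>poly q s - poly q t\<bar>\<^sup>2 / \<bar>s - t\<bar>"
        by (rule divide_right_mono) simp
      moreover have "bump q p m t = 0"
        using False by (simp add: bump_def)
      ultimately show "norm ((bump q p m s - bump q p m t) / (s - t))
          \<le> \<bar>poly p s\<bar> * fact (m + 2) * \<bar>Q s\<bar> * \<bar>poly q s - poly q t\<bar>"
        by (simp add: Q_def power2_eq_square mult.assoc)
    qed
  qed
  moreover have "bump q r k t = 0" for r k
    using False by (simp add: bump_def)
  ultimately show ?thesis
    by (simp add: has_field_derivative_iff)
qed

definition tensor :: "('n \<Rightarrow> real \<Rightarrow> real) \<Rightarrow> real ^ 'n \<Rightarrow> real" where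
  "tensor f x = (\<Prod>i\<in>UNIV. f i (x $ i))"

lemma tensor_has_derivative:
  assumes "\<And>i t. (f i has_real_derivative f' i t) (at t)"
  shows "(tensor f has_derivative
    (\<lambda>h. \<Sum>i\<in>UNIV. f' i (x $ i) * h $ i * (\<Prod>j\<in>UNIV - {i}. f j (x $ j)))) (at x)"
proof -
  have "((\<lambda>x. f i (x $ i)) has_derivative (\<lambda>h. f' i (x $ i) * h $ i)) (at x)" for i
    by (rule has_derivative_compose[of "\<lambda>x. x $ i" "\<lambda>h. h $ i" x UNIV "f i",
          OF bounded_linear_imp_has_derivative[OF bounded_linear_vec_nth]
          assms[unfolded has_field_derivative_def]])
  then show ?thesis
    unfolding tensor_def[abs_def] by (rule has_derivative_prod)
qed

lemma partial_tensor:
  assumes "\<And>i t. (f i has_real_derivative f' i t) (at t)"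
  shows "partial k (tensor f) = tensor (f(k := f' k))"
proof
  fix x
  have "partial k (tensor f) x =
      (\<Sum>i\<in>UNIV. f' i (x $ i) * axis k 1 $ i * (\<Prod>j\<in>UNIV - {i}. f j (x $ j)))"
    unfolding partial_def frechet_derivative_at[OF tensor_has_derivative[OF assms], symmetric] ..
  also have "\<dots> = (\<Sum>i\<in>UNIV. if i = k then f' k (x $ k) * (\<Prod>j\<in>UNIV - {k}. f j (x $ j)) else 0)"
    by (rule sum.cong) (auto simp: axis_def)
  also have "\<dots> = tensor (f(k := f' k)) x"
    by (simp add: tensor_def prod.remove[of UNIV k])
  finally show "partial k (tensor f) x = tensor (f(k := f' k)) x" .
qed

text \<open>
  A partial derivative of a product of bumps in the separate coordinates changes only the
  corresponding factor, and that factor stays a bump. Iterated derivatives are therefore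
  again such products, with the same \<open>q\<close>.
\<close>

lemma smooth_tensor_bump: "smooth (tensor (\<lambda>i. bump (q i) (p i) (m i)))"
proof -
  have iter: "\<exists>p m. foldr partial is (tensor (\<lambda>i. bump (q i) (p0 i) (m0 i))) =
      tensor (\<lambda>i. bump (q i) (p i) (m i))" for "is" p0 m0
  proof (induction "is")
    case (Cons k ks)
    then obtain p m where pm: "foldr partial ks (tensor (\<lambda>i. bump (q i) (p0 i) (m0 i))) =
      tensor (\<lambda>i. bump (q i) (p i) (m i))" by auto
    define p' where "p' i = pderiv (p i) * (q i)\<^sup>2 - smult (of_nat (m i)) (p i * q i * pderiv (q i))
      + p i * pderiv (q i)" for i
    have "partial k (tensor (\<lambda>i. bump (q i) (p i) (m i))) =
        tensor ((\<lambda>i. bump (q i) (p i) (m i))(k := bump (q k) (p' k) (m k + 2)))"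
      by (rule partial_tensor[where f' = "\<lambda>i. bump (q i) (p' i) (m i + 2)"])
        (simp only: p'_def bump_has_derivative)
    also have "(\<lambda>i. bump (q i) (p i) (m i))(k := bump (q k) (p' k) (m k + 2)) =
        (\<lambda>i. bump (q i) ((p(k := p' k)) i) ((m(k := m k + 2)) i))"
      by auto
    finally show ?case
      unfolding foldr_Cons o_apply pm by (intro exI)
  qed auto
  have "tensor (\<lambda>i. bump (q i) (p' i) (m' i)) differentiable (at x)" for p' m' x
    unfolding differentiable_def by (rule exI, rule tensor_has_derivative, rule bump_has_derivative)
  then show ?thesis
    unfolding smooth_def using iter by metis
qed

text \<open>
  In each coordinate \<open>exp (- 1 / (n * r))\<close> tends to \<open>1\<close> for \<open>r = (t - l) * (u - t) > 0\<close>, so scaling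
  the quadratic polynomial already gives the indicator of the open box in the limit.
\<close>

lemma test_functions_tendsto_indicator_box:
  fixes l u :: "real ^ 'n"
  assumes "cbox l u \<subseteq> \<Omega>" and nonempty: "box l u \<noteq> {}"
  obtains \<phi> where "\<And>n. \<phi> n \<in> test_fun \<Omega>"
    and "\<And>n x. 0 \<le> \<phi> n x \<and> \<phi> n x \<le> indicator (box l u) x"
    and "\<And>x. (\<lambda>n. \<phi> n x) \<longlonglongrightarrow> indicator (box l u) x"
proof
  \<comment> \<open>The parameter \<open>Suc n\<close> avoids a vanishing polynomial for \<open>n = 0\<close>.\<close>
  define q where "q n i = smult (of_nat (Suc n)) ([:- l $ i, 1:] * [:u $ i, -1:])" for n i
  define \<phi> where "\<phi> n = tensor (\<lambda>i. bump (q n i) 1 0)" for n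
  have poly_q: "poly (q n i) t = real (Suc n) * ((t - l $ i) * (u $ i - t))" for n i t
    by (simp add: q_def algebra_simps)
  have less: "l $ i < u $ i" for i
    using nonempty by (force simp: mem_box_cart dest: less_trans)
  have pos: "0 < poly (q n i) t \<longleftrightarrow> l $ i < t \<and> t < u $ i" for n i t
    unfolding poly_q using less[of i] by (auto simp: zero_less_mult_iff)
  have factor: "bump (q n i) 1 0 t = (if l $ i < t \<and> t < u $ i
      then exp (- 1 / (real (Suc n) * ((t - l $ i) * (u $ i - t)))) else 0)" for n i t
    unfolding bump_def pos unfolding poly_q by simp
  have inside: "\<phi> n x = (\<Prod>i\<in>UNIV. exp (- 1 / (real (Suc n) * ((x $ i - l $ i) * (u $ i - x $ i)))))"
    if "x \<in> box l u" for n x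
    using that by (simp add: \<phi>_def tensor_def factor mem_box_cart)
  have outside: "\<phi> n x = 0" if "x \<notin> box l u" for n x
  proof -
    obtain i where "\<not> (l $ i < x $ i \<and> x $ i < u $ i)"
      using \<open>x \<notin> box l u\<close> by (auto simp: mem_box_cart)
    then show ?thesis
      unfolding \<phi>_def tensor_def factor by (intro prod_zero) auto
  qed
  have ind: "0 \<le> \<phi> n x \<and> \<phi> n x \<le> indicator (box l u) x" for n x
  proof (cases "x \<in> box l u")
    case True
    then have "exp (- 1 / (real (Suc n) * ((x $ i - l $ i) * (u $ i - x $ i)))) \<le> 1" for i
      by (auto simp: mem_box_cart less_imp_le)
    with True show ?thesis
      by (auto simp: inside intro!: prod_nonneg prod_le_1)
  qed (simp add: outside)
  then show "0 \<le> \<phi> n x \<and> \<phi> n x \<le> indicator (box l u) x" for n x .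
  show "(\<lambda>n. \<phi> n x) \<longlonglongrightarrow> indicator (box l u) x" for x
  proof (cases "x \<in> box l u")
    case True
    have "(\<lambda>n. exp (- 1 / (real (Suc n) * r))) \<longlonglongrightarrow> 1" if "0 < r" for r
      using that by real_asymp
    then have "(\<lambda>n. \<Prod>i\<in>UNIV. exp (- 1 / (real (Suc n) * ((x $ i - l $ i) * (u $ i - x $ i)))))
        \<longlonglongrightarrow> (\<Prod>i\<in>(UNIV :: 'n set). 1)"
      using True by (intro tendsto_prod) (auto simp: mem_box_cart)
    then show ?thesis
      using True by (simp add: inside)
  qed (simp add: outside)
  show "\<phi> n \<in> test_fun \<Omega>" for n
  proof -
    have "{x. \<phi> n x \<noteq> 0} \<subseteq> cbox l u"
      using outside[of _ n] box_subset_cbox[of l u] by blast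
    then have "closure {x. \<phi> n x \<noteq> 0} \<subseteq> cbox l u"
      by (rule closure_minimal) (rule closed_cbox)
    moreover from this have "compact (closure {x. \<phi> n x \<noteq> 0})"
      by (meson bounded_cbox bounded_subset closed_closure compact_eq_bounded_closed)
    ultimately show ?thesis
      using assms(1) smooth_tensor_bump[of "q n" "\<lambda>_. 1" "\<lambda>_. 0"]
      by (auto simp: test_fun_def \<phi>_def)
  qed
qed

section \<open>The fundamental lemma of the calculus of variations\<close>

lemma Lp_loc_1_absolutely_integrable:
  assumes "open \<Omega>" "f \<in> Lp_loc 1 \<Omega>" "compact K" "K \<subseteq> \<Omega>"
  shows "f absolutely_integrable_on K"
proof (rule measurable_bounded_by_integrable_imp_absolutely_integrable)
  show K: "K \<in> sets lebesgue"
    using assms(3) by (simp add: borel_compact)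
  show "f \<in> borel_measurable (lebesgue_on K)"
    using assms(2,4) by (auto simp: Lp_loc_def intro: measurable_restrict_mono)
  show "(\<lambda>x. \<bar>f x\<bar>) integrable_on K"
    using assms(2-4) by (auto simp: Lp_loc_def intro: set_lebesgue_integral_eq_integral)
qed simp

lemma Lp_loc_1_times_integrable:
  assumes \<Omega>: "open \<Omega>" and f: "f \<in> Lp_loc 1 \<Omega>" and K: "compact K" "K \<subseteq> \<Omega>"
    and \<psi>: "continuous_on UNIV \<psi>" and zero: "\<And>x. x \<notin> K \<Longrightarrow> \<psi> x = 0"
  shows "set_integrable lebesgue \<Omega> (\<lambda>x. f x * \<psi> x)"
proof -
  have K_sets: "K \<in> sets lebesgue"
    using K(1) by (simp add: borel_compact)
  have cont: "continuous_on K \<psi>"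
    using \<psi> by (rule continuous_on_subset) simp
  have "(\<lambda>x. \<psi> x * f x) absolutely_integrable_on K"
  proof (rule absolutely_integrable_bounded_measurable_product[OF bilinear_times _ K_sets])
    show "\<psi> \<in> borel_measurable (lebesgue_on K)"
      using cont K_sets by (rule continuous_imp_measurable_on_sets_lebesgue)
    show "bounded (\<psi> ` K)"
      using cont K(1) by (meson compact_continuous_image compact_imp_bounded)
  qed (rule Lp_loc_1_absolutely_integrable[OF \<Omega> f K])
  moreover have "(\<lambda>x. indicator K x *\<^sub>R (\<psi> x * f x)) = (\<lambda>x. indicator \<Omega> x *\<^sub>R (f x * \<psi> x))"
    using K(2) zero by (auto simp: indicator_def fun_eq_iff)
  ultimately show ?thesis
    by (simp add: set_integrable_def)
qed

lemma test_fun_differentiable: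
  assumes "\<phi> \<in> test_fun \<Omega>"
  shows "\<phi> differentiable (at x)" and "partial i \<phi> differentiable (at x)"
  using assms[unfolded test_fun_def smooth_def, THEN CollectD, THEN conjunct1, rule_format, of "[]"]
    assms[unfolded test_fun_def smooth_def, THEN CollectD, THEN conjunct1, rule_format, of "[i]"]
  by simp_all

lemma continuous_on_test_fun:
  assumes "\<phi> \<in> test_fun \<Omega>"
  shows "continuous_on UNIV \<phi>" and "continuous_on UNIV (partial i \<phi>)"
  using test_fun_differentiable[OF assms]
  by (auto intro!: continuous_at_imp_continuous_on differentiable_imp_continuous_within)

text \<open>
  Dominated convergence along test functions that approximate the indicator of the box.
\<close>

lemma integral_box_eq_0:
  assumes \<Omega>: "open \<Omega>" and f: "f \<in> Lp_loc 1 \<Omega>" and box: "cbox l u \<subseteq> \<Omega>"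
    and test: "\<And>\<phi>. \<phi> \<in> test_fun \<Omega> \<Longrightarrow> (LINT x:\<Omega>|lebesgue. f x * \<phi> x) = 0"
  shows "(LINT x:box l u|lebesgue. f x) = 0"
proof (cases "box l u = {}")
  case False
  then obtain \<phi> where \<phi>: "\<And>n. \<phi> n \<in> test_fun \<Omega>"
    and ind: "\<And>n x. 0 \<le> \<phi> n x \<and> \<phi> n x \<le> indicator (box l u) x"
    and lim: "\<And>x. (\<lambda>n. \<phi> n x) \<longlonglongrightarrow> indicator (box l u) x"
    using test_functions_tendsto_indicator_box[OF box] by blast
  have zero: "\<phi> n x = 0" if "x \<notin> box l u" for n x
    using ind[of n x] that by simp
  have dom: "set_integrable lebesgue (box l u) f"
    using Lp_loc_1_absolutely_integrable[OF \<Omega> f compact_cbox box]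
    by (rule set_integrable_subset) (simp_all add: box_subset_cbox)
  have "\<phi> n \<in> borel_measurable lborel" for n
    using continuous_on_test_fun[OF \<phi>[of n]] by (simp add: borel_measurable_continuous_onI)
  then have \<phi>_meas: "\<phi> n \<in> borel_measurable lebesgue" for n
    by (rule measurable_completion)
  have meas: "(\<lambda>x. indicator (box l u) x *\<^sub>R f x) \<in> borel_measurable lebesgue"
    using dom unfolding set_integrable_def by (rule borel_measurable_integrable)
  have prod_meas: "(\<lambda>x. \<psi> x * (indicator (box l u) x *\<^sub>R f x)) \<in> borel_measurable lebesgue"
    if "\<psi> \<in> borel_measurable lebesgue" for \<psi>
    using that meas by (rule borel_measurable_times)
  have ind_meas: "indicat_real (box l u) \<in> borel_measurable lebesgue"
    by (intro borel_measurable_indicator) simp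
  have eq: "indicator \<Omega> x *\<^sub>R (f x * \<phi> n x) = \<phi> n x * (indicator (box l u) x *\<^sub>R f x)" for n x
    using box box_subset_cbox[of l u] zero by (auto simp: indicator_def)
  have "(\<lambda>n. LINT x|lebesgue. \<phi> n x * (indicator (box l u) x *\<^sub>R f x)) \<longlonglongrightarrow>
      (LINT x|lebesgue. indicator (box l u) x * (indicator (box l u) x *\<^sub>R f x))"
  proof (rule integral_dominated_convergence)
    show "integrable lebesgue (\<lambda>x. norm (indicator (box l u) x *\<^sub>R f x))"
      using dom unfolding set_integrable_def by (rule integrable_norm)
    show "AE x in lebesgue. norm (\<phi> n x * (indicator (box l u) x *\<^sub>R f x))
        \<le> norm (indicator (box l u) x *\<^sub>R f x)" for n
    proof (rule AE_I2)
      fix x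
      have "\<bar>\<phi> n x\<bar> \<le> 1"
        using ind[of n x] by (cases "x \<in> box l u") auto
      then show "norm (\<phi> n x * (indicator (box l u) x *\<^sub>R f x))
        \<le> norm (indicator (box l u) x *\<^sub>R f x)"
        by (simp add: abs_mult mult_left_le_one_le)
    qed
    show "AE x in lebesgue. (\<lambda>n. \<phi> n x * (indicator (box l u) x *\<^sub>R f x)) \<longlonglongrightarrow>
        indicator (box l u) x * (indicator (box l u) x *\<^sub>R f x)"
      by (intro AE_I2 tendsto_mult lim tendsto_const)
  qed (rule prod_meas, rule ind_meas, rule prod_meas, rule \<phi>_meas)
  moreover have "(LINT x|lebesgue. \<phi> n x * (indicator (box l u) x *\<^sub>R f x)) = 0" for n
    using test[OF \<phi>[of n]] by (simp only: set_lebesgue_integral_def eq)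
  ultimately have "(LINT x|lebesgue. indicator (box l u) x * (indicator (box l u) x *\<^sub>R f x)) = 0"
    by (simp add: LIMSEQ_const_iff)
  moreover have "indicator (box l u) x * (indicator (box l u) x *\<^sub>R f x) =
      indicator (box l u) x *\<^sub>R f x" for x
    by (simp add: indicator_def)
  ultimately show ?thesis
    by (simp only: set_lebesgue_integral_def)
qed (simp add: set_lebesgue_integral_def)

text \<open>
  Boxes generate the Borel sets and are stable under intersection, so the integral vanishes
  over every Borel set by the \<open>\<pi>\<close>-\<open>\<lambda>\<close> argument. Since the generator lives in the Borel sets,
  the function is first replaced by a Borel measurable one that is equal to it almost everywhere.
  The vanishing of the whole integral is needed for complements.
\<close>

lemma AE_eq_0_if_integral_boxes_eq_0:
  fixes h :: "'a::euclidean_space \<Rightarrow> real"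
  assumes h: "integrable lebesgue h" and whole: "integral\<^sup>L lebesgue h = 0"
    and boxes: "\<And>l u. (LINT x:box l u|lebesgue. h x) = 0"
  shows "AE x in lebesgue. h x = 0"
proof -
  obtain g where g: "g \<in> borel_measurable lborel" "AE x in lborel. h x = g x"
    using completion_ex_borel_measurable_real[of h lborel] h by auto
  then have hg: "AE x in lebesgue. h x = g x"
    by (intro AE_completion)
  have [measurable]: "g \<in> borel_measurable lebesgue"
    using g(1) by (rule measurable_completion)
  have "integrable lebesgue g"
    using h by (rule integrable_cong_AE_imp) (use hg in auto)
  then have int: "integrable lborel g"
    using g(1) by (simp add: integrable_completion)
  have transfer: "(LINT x:A|lborel. g x) = (LINT x:A|lebesgue. h x)" if "A \<in> sets borel" for A
  proof -
    have "(LINT x:A|lborel. g x) = (LINT x:A|lebesgue. g x)"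
      unfolding set_lebesgue_integral_def using g(1) that
      by (intro integral_completion[symmetric]) auto
    also have "\<dots> = (LINT x:A|lebesgue. h x)"
      unfolding set_lebesgue_integral_def
    proof (rule integral_cong_AE)
      show "AE x in lebesgue. indicat_real A x *\<^sub>R g x = indicat_real A x *\<^sub>R h x"
        using hg by eventually_elim simp
    qed (use h that in \<open>auto intro!: borel_measurable_times borel_measurable_indicator borel_measurable_integrable[OF h]\<close>)
    finally show ?thesis .
  qed
  have set_int: "set_integrable lborel A g" if "A \<in> sets lborel" for A
    unfolding set_integrable_def using that int by (rule integrable_mult_indicator)
  have "AE x in lborel. g x = 0"
  proof (rule sigma_finite_measure.density_zero[OF sigma_finite_lborel int])
    fix A :: "'a set"
    assume "A \<in> sets lborel"
    then have A: "A \<in> sigma_sets UNIV (range (\<lambda>(l, u). box l u :: 'a set))"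
      by (simp add: borel_eq_box)
    have stable: "Int_stable (range (\<lambda>(l, u). box l u :: 'a set))"
      by (auto simp: Int_stable_def box_Int_box image_iff)
    have subset_Pow_UNIV: "range (\<lambda>(l, u). box l u :: 'a set) \<subseteq> Pow UNIV"
      by simp
    have UNIV: "(LINT x:UNIV|lborel. g x) = 0"
      using transfer[of UNIV] whole by (simp add: set_lebesgue_integral_def)
    have sets: "sigma_sets UNIV (range (\<lambda>(l, u). box l u :: 'a set)) = sets borel"
      by (simp add: borel_eq_box)
    show "(LINT x:A|lborel. g x) = 0"
      using stable subset_Pow_UNIV A
    proof (induction rule: sigma_sets_induct_disjoint)
      case (basic A)
      then show ?case using boxes transfer by auto
    next
      case empty
      show ?case by (simp add: set_lebesgue_integral_def)
    next
      case (compl A)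
      then have [measurable]: "A \<in> sets borel" by (simp add: sets)
      have "(LINT x:UNIV - A|lborel. g x) + (LINT x:A|lborel. g x) = (LINT x:UNIV|lborel. g x)"
        by (subst set_integral_Un[symmetric]) (auto intro!: set_int simp: Un_commute)
      then show ?case using compl UNIV by simp
    next
      case (union A)
      then have meas: "A n \<in> sets lborel" for n by (auto simp: sets)
      have "(LINT x:(\<Union>n. A n)|lborel. g x) = (\<Sum>n. LINT x:A n|lborel. g x)"
        using union(1) meas
        by (intro lebesgue_integral_countable_add)
          (auto simp: disjoint_family_on_def intro!: set_int)
      then show ?case using union by simp
    qed
  qed
  then have "AE x in lebesgue. g x = 0"
    by (rule AE_completion)
  with hg show ?thesis by eventually_elim simp
qed

text \<open>
  The fundamental lemma of the calculus of variations. On a closed box inside \<open>\<Omega>\<close> the function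
  is integrable, and the test functions detect its integral over every subbox; countably
  many such boxes fill \<open>\<Omega>\<close>.
\<close>

lemma AE_eq_0_if_integral_test_fun_eq_0:
  fixes f :: "real ^ 'n \<Rightarrow> real"
  assumes \<Omega>: "open \<Omega>" and f: "f \<in> Lp_loc 1 \<Omega>"
    and test: "\<And>\<phi>. \<phi> \<in> test_fun \<Omega> \<Longrightarrow> (LINT x:\<Omega>|lebesgue. f x * \<phi> x) = 0"
  shows "AE x in lebesgue_on \<Omega>. f x = 0"
proof -
  have cbox: "AE x in lebesgue. x \<in> cbox l u \<longrightarrow> f x = 0" if sub: "cbox l u \<subseteq> \<Omega>" for l u
  proof -
    define h where "h x = indicator (box l u) x * f x" for x
    have "set_integrable lebesgue (box l u) f"
      using Lp_loc_1_absolutely_integrable[OF \<Omega> f compact_cbox sub]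
      by (rule set_integrable_subset) (simp_all add: box_subset_cbox)
    then have h: "integrable lebesgue h"
      by (simp add: set_integrable_def h_def[abs_def])
    have "AE x in lebesgue. h x = 0"
    proof (rule AE_eq_0_if_integral_boxes_eq_0[OF h])
      show "integral\<^sup>L lebesgue h = 0"
        using integral_box_eq_0[OF \<Omega> f sub test] by (simp add: set_lebesgue_integral_def h_def[abs_def])
      fix l' u' :: "real ^ 'n"
      \<comment> \<open>The closed box with these corners lies in \<open>cbox l u\<close> even if the open boxes are disjoint.\<close>
      define l2 u2 where "l2 = (\<chi> i. max (l $ i) (l' $ i))" and "u2 = (\<chi> i. min (u $ i) (u' $ i))"
      have int: "box l u \<inter> box l' u' = box l2 u2" "cbox l2 u2 \<subseteq> cbox l u"
        by (auto simp: l2_def u2_def mem_box_cart)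
      have "indicator (box l' u') x *\<^sub>R h x = indicator (box l2 u2) x *\<^sub>R f x" for x
        unfolding h_def int(1)[symmetric] by (auto simp: indicator_def)
      then show "(LINT x:box l' u'|lebesgue. h x) = 0"
        using integral_box_eq_0[OF \<Omega> f _ test] int(2) sub
        by (simp add: set_lebesgue_integral_def)
    qed
    moreover have "AE x in lebesgue. x \<notin> cbox l u - box l u"
      using negligible_frontier_interval[of l u]
      by (intro AE_not_in) (simp add: negligible_iff_null_sets)
    ultimately show ?thesis
      by eventually_elim (auto simp: h_def indicator_def split: if_splits)
  qed
  obtain \<D> where \<D>: "countable \<D>" "\<D> \<subseteq> Pow \<Omega>" "\<And>X. X \<in> \<D> \<Longrightarrow> \<exists>l u. X = cbox l u" "\<Union>\<D> = \<Omega>"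
    using open_countable_Union_open_cbox[OF \<Omega>] by blast
  have "AE x in lebesgue. \<forall>X\<in>\<D>. x \<in> X \<longrightarrow> f x = 0"
    using \<D>(2,3) cbox by (intro AE_ball_countable'[OF _ \<D>(1)]) blast
  then have "AE x in lebesgue. x \<in> \<Omega> \<longrightarrow> f x = 0"
    by eventually_elim (use \<D>(4) in blast)
  then show ?thesis
    using \<Omega> by (simp add: AE_restrict_space_iff)
qed

section \<open>Weak derivatives and the weak operator\<close>

lemma test_fun_support:
  assumes "\<phi> \<in> test_fun \<Omega>"
  obtains K where "compact K" "K \<subseteq> \<Omega>" "\<And>x. x \<notin> K \<Longrightarrow> \<phi> x = 0"
    "\<And>i x. x \<notin> K \<Longrightarrow> partial i \<phi> x = 0"
proof
  let ?K = "closure {x. \<phi> x \<noteq> 0}"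
  show "compact ?K" "?K \<subseteq> \<Omega>"
    using assms by (auto simp: test_fun_def)
  show zero: "\<phi> x = 0" if "x \<notin> ?K" for x
    using that closure_subset[of "{x. \<phi> x \<noteq> 0}"] by auto
  show "partial i \<phi> x = 0" if "x \<notin> ?K" for i x
  proof -
    have "partial i \<phi> x = partial i (\<lambda>_. 0) x"
    proof (rule partial_cong_open)
      show "open (- ?K)" by (intro open_Compl closed_closure)
    qed (use zero that in blast)+
    then show ?thesis
      by (simp add: partial_def)
  qed
qed

lemma has_derivative_along_axis:
  assumes "\<And>y. \<phi> differentiable (at y)"
  shows "((\<lambda>t. \<phi> (t *\<^sub>R axis i 1 + x)) has_real_derivative partial i \<phi> (t *\<^sub>R axis i 1 + x)) (at t)"
proof -
  let ?D = "frechet_derivative \<phi> (at (t *\<^sub>R axis i 1 + x))"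
  have D: "(\<phi> has_derivative ?D) (at (t *\<^sub>R axis i 1 + x))"
    using assms by (simp flip: frechet_derivative_works)
  have "((\<lambda>t. t *\<^sub>R axis i 1 + x) has_derivative (\<lambda>t. t *\<^sub>R axis i 1)) (at t)"
    by (auto intro!: derivative_eq_intros)
  from has_derivative_compose[OF this D]
  have "((\<lambda>t. \<phi> (t *\<^sub>R axis i 1 + x)) has_derivative (\<lambda>t. ?D (t *\<^sub>R axis i 1))) (at t)" .
  moreover have "(\<lambda>s. ?D (s *\<^sub>R axis i 1)) = (*) (partial i \<phi> (t *\<^sub>R axis i 1 + x))"
    using linear_scale[OF has_derivative_linear[OF D]] by (simp add: partial_def fun_eq_iff)
  ultimately show ?thesis
    by (simp add: has_field_derivative_def)
qed

text \<open>
  By translation invariance the difference quotients of \<open>\<phi>\<close> in direction \<open>i\<close> have integral \<open>0\<close>.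
  They are bounded by the maximum of the derivative, they vanish outside a fixed ball when the step
  is at most \<open>1\<close>, and they converge to the partial derivative.
\<close>

lemma integral_partial_test_fun:
  assumes "open \<Omega>" and \<phi>: "\<phi> \<in> test_fun \<Omega>"
  shows "(LINT x:\<Omega>|lebesgue. partial i \<phi> x) = 0"
proof -
  obtain K where K: "compact K" "K \<subseteq> \<Omega>" and zero: "\<And>x. x \<notin> K \<Longrightarrow> \<phi> x = 0"
    and zero': "\<And>x. x \<notin> K \<Longrightarrow> partial i \<phi> x = 0"
    using test_fun_support[OF \<phi>] by metis
  have diff: "\<And>y. \<phi> differentiable (at y)"
    using test_fun_differentiable[OF \<phi>] by blast
  note cont = continuous_on_test_fun[OF \<phi>]
  obtain C where C: "\<And>x. \<bar>partial i \<phi> x\<bar> \<le> C"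
  proof -
    have "bounded (partial i \<phi> ` K)"
      using K(1) cont(2) by (meson compact_continuous_image compact_imp_bounded continuous_on_subset subset_UNIV)
    then obtain B where B: "\<And>x. x \<in> K \<Longrightarrow> \<bar>partial i \<phi> x\<bar> \<le> B" "0 \<le> B"
      by (metis bounded_pos imageI less_imp_le real_norm_def)
    then have "\<bar>partial i \<phi> x\<bar> \<le> B" for x
      by (cases "x \<in> K") (auto simp: zero')
    then show ?thesis by (rule that)
  qed
  obtain R where R: "\<And>x. x \<in> K \<Longrightarrow> norm x \<le> R"
    using K(1) by (meson bounded_iff compact_imp_bounded)
  \<comment> \<open>Step sizes in \<open>{0<..1}\<close>, so that all translates of the support stay in one ball.\<close>
  define h where "h n = 1 / real (Suc n)" for n
  have h: "0 < h n" "h n \<le> 1" for n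
    by (simp_all add: h_def)
  define D where "D n x = (\<phi> (h n *\<^sub>R axis i 1 + x) - \<phi> x) / h n" for n x
  have meas [measurable]: "\<phi> \<in> borel_measurable borel" "partial i \<phi> \<in> borel_measurable borel"
    using cont by (auto intro: borel_measurable_continuous_onI)
  have int_D: "integral\<^sup>L lborel (D n) = 0" for n
  proof -
    have "integrable lborel (\<lambda>x. indicator K x *\<^sub>R \<phi> x)"
      using K(1) cont(1) by (intro borel_integrable_compact) (auto intro: continuous_on_subset)
    moreover have "(\<lambda>x. indicator K x *\<^sub>R \<phi> x) = \<phi>"
      using zero by (auto simp: indicator_def fun_eq_iff)
    ultimately have int: "integrable lborel \<phi>" by simp
    have "integrable lborel (\<lambda>x. \<phi> (h n *\<^sub>R axis i 1 + x))"
      using int integrable_distr_eq[of "(+) (h n *\<^sub>R axis i 1)" lborel borel \<phi>]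
      by (simp add: lborel_distr_plus)
    moreover have "(\<integral>x. \<phi> (h n *\<^sub>R axis i 1 + x) \<partial>lborel) = integral\<^sup>L lborel \<phi>"
      using integral_distr[of "(+) (h n *\<^sub>R axis i 1)" lborel borel \<phi>]
      by (simp add: lborel_distr_plus)
    ultimately show ?thesis
      using int by (simp add: D_def[abs_def])
  qed
  have "(\<lambda>n. integral\<^sup>L lborel (D n)) \<longlonglongrightarrow> integral\<^sup>L lborel (partial i \<phi>)"
  proof (rule integral_dominated_convergence)
    show "integrable lborel (\<lambda>x. indicator (cball 0 (R + 1)) x *\<^sub>R C)"
      by (intro borel_integrable_compact) auto
    show "AE x in lborel. (\<lambda>n. D n x) \<longlonglongrightarrow> partial i \<phi> x"
    proof (rule AE_I2)
      fix x
      have "((\<lambda>s. (\<phi> (s *\<^sub>R axis i 1 + x) - \<phi> x) / s) \<longlongrightarrow> partial i \<phi> x) (at 0)"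
        using has_derivative_along_axis[OF diff, of i x 0] by (simp add: has_field_derivative_iff)
      moreover have "filterlim h (at 0) sequentially"
        unfolding filterlim_at h_def[abs_def]
        by (intro conjI LIMSEQ_Suc[OF lim_inverse_n'] always_eventually) auto
      ultimately show "(\<lambda>n. D n x) \<longlonglongrightarrow> partial i \<phi> x"
        unfolding D_def by (rule filterlim_compose)
    qed
    show "AE x in lborel. norm (D n x) \<le> indicator (cball 0 (R + 1)) x *\<^sub>R C" for n
    proof (rule AE_I2)
      fix x
      show "norm (D n x) \<le> indicator (cball 0 (R + 1)) x *\<^sub>R C"
      proof (cases "x \<in> cball 0 (R + 1)")
        case True
        obtain s where "\<phi> (h n *\<^sub>R axis i 1 + x) - \<phi> (0 *\<^sub>R axis i 1 + x) =
            (h n - 0) * partial i \<phi> (s *\<^sub>R axis i 1 + x)"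
          using MVT2[where a = 0 and b = "h n" and f = "\<lambda>s. \<phi> (s *\<^sub>R axis i 1 + x)",
              OF h(1) has_derivative_along_axis[OF diff]] by blast
        then have "D n x = partial i \<phi> (s *\<^sub>R axis i 1 + x)"
          using h(1)[of n] by (simp add: D_def)
        then show ?thesis using True C by simp
      next
        case False
        have "norm x \<le> norm (h n *\<^sub>R axis i 1 + x) + norm (h n *\<^sub>R axis i 1 :: real ^ 'a)"
          by (metis add_diff_cancel_left' norm_triangle_ineq4)
        also have "norm (h n *\<^sub>R axis i 1 :: real ^ 'a) \<le> 1"
          using h[of n] by (simp add: norm_axis_1)
        finally have "x \<notin> K" "h n *\<^sub>R axis i 1 + x \<notin> K"
          using False R by force+
        then show ?thesis using False by (simp add: D_def zero)
      qed
    qed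
    show "D n \<in> borel_measurable lborel" for n
      unfolding D_def[abs_def] by measurable
  qed simp
  then have "integral\<^sup>L lborel (partial i \<phi>) = 0"
    by (simp add: int_D LIMSEQ_const_iff)
  moreover have "(\<lambda>x. indicator \<Omega> x *\<^sub>R partial i \<phi> x) = partial i \<phi>"
    using K(2) zero' by (auto simp: indicator_def fun_eq_iff)
  ultimately show ?thesis
    by (simp add: set_lebesgue_integral_def integral_completion)
qed

lemma Lp_loc_measurable: "f \<in> Lp_loc p \<Omega> \<Longrightarrow> f \<in> borel_measurable (lebesgue_on \<Omega>)"
  unfolding Lp_loc_def mem_Collect_eq by (rule conjunct1)

lemma Lp_loc_1_iff:
  assumes "open \<Omega>"
  shows "f \<in> Lp_loc 1 \<Omega> \<longleftrightarrow> f \<in> borel_measurable (lebesgue_on \<Omega>) \<and>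
    (\<forall>K. compact K \<and> K \<subseteq> \<Omega> \<longrightarrow> f absolutely_integrable_on K)" (is "_ \<longleftrightarrow> ?R")
proof
  assume f: "f \<in> Lp_loc 1 \<Omega>"
  then show ?R
    using Lp_loc_1_absolutely_integrable[OF assms f] Lp_loc_measurable[OF f] by blast
next
  assume R: ?R
  have "(\<lambda>x. \<bar>f x\<bar> ^ 1) absolutely_integrable_on K" if "compact K" "K \<subseteq> \<Omega>" for K
    unfolding power_one_right using R that by (intro set_integrable_abs) blast
  then show "f \<in> Lp_loc 1 \<Omega>"
    unfolding Lp_loc_def mem_Collect_eq using R by blast
qed

lemma Lp_loc_1_add:
  assumes "open \<Omega>" "f \<in> Lp_loc 1 \<Omega>" "g \<in> Lp_loc 1 \<Omega>"
  shows "(\<lambda>x. f x + g x) \<in> Lp_loc 1 \<Omega>"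
  unfolding Lp_loc_1_iff[OF assms(1)]
proof (intro conjI allI impI)
  show "(\<lambda>x. f x + g x) \<in> borel_measurable (lebesgue_on \<Omega>)"
    using assms(2,3) by (intro borel_measurable_add Lp_loc_measurable)
  show "(\<lambda>x. f x + g x) absolutely_integrable_on K" if "compact K \<and> K \<subseteq> \<Omega>" for K
    using that Lp_loc_1_absolutely_integrable[OF assms(1)] assms(2,3)
    by (intro set_integral_add(1)) blast+
qed

lemma Lp_loc_1_uminus:
  assumes "f \<in> Lp_loc 1 \<Omega>"
  shows "(\<lambda>x. - f x) \<in> Lp_loc 1 \<Omega>"
proof -
  have "(\<lambda>x. - f x) \<in> borel_measurable (lebesgue_on \<Omega>)"
    using Lp_loc_measurable[OF assms] by (rule borel_measurable_uminus)
  then show ?thesis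
    using assms unfolding Lp_loc_def mem_Collect_eq abs_minus_cancel by blast
qed

lemma Lp_loc_1_const:
  assumes "open \<Omega>"
  shows "(\<lambda>x. M) \<in> Lp_loc 1 \<Omega>"
  unfolding Lp_loc_1_iff[OF assms]
proof (intro conjI allI impI)
  show "(\<lambda>x. M) absolutely_integrable_on K" if "compact K \<and> K \<subseteq> \<Omega>" for K
    using that by (intro absolutely_integrable_on_const lmeasurable_compact) blast
qed (rule borel_measurable_const)

lemma test_fun_integrable:
  assumes \<Omega>: "open \<Omega>" and f: "f \<in> Lp_loc 1 \<Omega>" and \<phi>: "\<phi> \<in> test_fun \<Omega>"
  shows "set_integrable lebesgue \<Omega> (\<lambda>x. f x * \<phi> x)"
    and "set_integrable lebesgue \<Omega> (\<lambda>x. f x * partial i \<phi> x)"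
proof -
  obtain K where K: "compact K" "K \<subseteq> \<Omega>" "\<And>x. x \<notin> K \<Longrightarrow> \<phi> x = 0"
    "\<And>x. x \<notin> K \<Longrightarrow> partial i \<phi> x = 0"
    using test_fun_support[OF \<phi>] by metis
  then show "set_integrable lebesgue \<Omega> (\<lambda>x. f x * \<phi> x)"
    and "set_integrable lebesgue \<Omega> (\<lambda>x. f x * partial i \<phi> x)"
    using Lp_loc_1_times_integrable[OF \<Omega> f K(1,2)] continuous_on_test_fun[OF \<phi>] by blast+
qed

text \<open>
  Constants have weak derivative \<open>0\<close>, since derivatives of test functions integrate to \<open>0\<close>.
\<close>

lemma has_weak_partial_minus_const:
  assumes \<Omega>: "open \<Omega>" and u: "has_weak_partial \<Omega> i u g"
  shows "has_weak_partial \<Omega> i (\<lambda>x. u x - M) g"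
  unfolding has_weak_partial_def
proof (intro conjI ballI)
  show "(\<lambda>x. u x - M) \<in> Lp_loc 1 \<Omega>"
    using Lp_loc_1_add[OF \<Omega> _ Lp_loc_1_const[OF \<Omega>, of "- M"], of u] u
    by (simp add: has_weak_partial_def)
  show "g \<in> Lp_loc 1 \<Omega>"
    using u by (simp add: has_weak_partial_def)
  fix \<phi>
  assume \<phi>: "\<phi> \<in> test_fun \<Omega>"
  have "(LINT x:\<Omega>|lebesgue. (u x - M) * partial i \<phi> x) =
      (LINT x:\<Omega>|lebesgue. u x * partial i \<phi> x) - (LINT x:\<Omega>|lebesgue. M * partial i \<phi> x)"
    unfolding left_diff_distrib
    using u by (intro set_integral_diff test_fun_integrable[OF \<Omega> _ \<phi>] Lp_loc_1_const \<Omega>)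
      (simp add: has_weak_partial_def)
  also have "\<dots> = - (LINT x:\<Omega>|lebesgue. g x * \<phi> x)"
    using u \<phi> by (simp add: has_weak_partial_def integral_partial_test_fun[OF \<Omega> \<phi>])
  finally show "(LINT x:\<Omega>|lebesgue. (u x - M) * partial i \<phi> x) =
      - (LINT x:\<Omega>|lebesgue. g x * \<phi> x)" .
qed

text \<open>
  The two functions have exactly the same weak derivatives, so the chosen representatives
  are equal, not only almost everywhere.
\<close>

lemma weak_partial_minus_const:
  assumes "open \<Omega>"
  shows "weak_partial \<Omega> i (\<lambda>x. u x - M) = weak_partial \<Omega> i u"
proof -
  have "has_weak_partial \<Omega> i (\<lambda>x. u x - M) g \<longleftrightarrow> has_weak_partial \<Omega> i u g" for g
    using has_weak_partial_minus_const[OF assms, of i u g M]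
      has_weak_partial_minus_const[OF assms, of i "\<lambda>x. u x - M" g "- M"] by auto
  then show ?thesis by (simp add: weak_partial_def)
qed

lemma has_weak_partial_uminus:
  assumes "has_weak_partial \<Omega> i u g"
  shows "has_weak_partial \<Omega> i (\<lambda>x. - u x) (\<lambda>x. - g x)"
  using assms unfolding has_weak_partial_def
  by (auto intro!: Lp_loc_1_uminus[unfolded One_nat_def] simp: set_lebesgue_integral_def)

lemma has_weak_partial_unique:
  assumes \<Omega>: "open \<Omega>" and g: "has_weak_partial \<Omega> i u g" and h: "has_weak_partial \<Omega> i u h"
  shows "AE x in lebesgue_on \<Omega>. g x = h x"
proof -
  have Lp: "g \<in> Lp_loc 1 \<Omega>" "h \<in> Lp_loc 1 \<Omega>"
    using g h by (auto simp: has_weak_partial_def)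
  have "AE x in lebesgue_on \<Omega>. g x + - h x = 0"
  proof (rule AE_eq_0_if_integral_test_fun_eq_0[OF \<Omega>])
    show "(\<lambda>x. g x + - h x) \<in> Lp_loc 1 \<Omega>"
      using Lp by (intro Lp_loc_1_add Lp_loc_1_uminus \<Omega>)
    fix \<phi>
    assume \<phi>: "\<phi> \<in> test_fun \<Omega>"
    have "(LINT x:\<Omega>|lebesgue. (g x + - h x) * \<phi> x) =
        (LINT x:\<Omega>|lebesgue. g x * \<phi> x) - (LINT x:\<Omega>|lebesgue. h x * \<phi> x)"
      using set_integral_diff(2)[OF test_fun_integrable(1)[OF \<Omega> Lp(1) \<phi>]
          test_fun_integrable(1)[OF \<Omega> Lp(2) \<phi>]] by (simp add: left_diff_distrib)
    then show "(LINT x:\<Omega>|lebesgue. (g x + - h x) * \<phi> x) = 0"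
      using g h \<phi> by (simp add: has_weak_partial_def)
  qed
  then show ?thesis by eventually_elim simp
qed

text \<open>
  Used to differentiate a second time: the chosen weak derivative of \<open>- u\<close> agrees with the
  negative of that of \<open>u\<close> only almost everywhere.
\<close>

lemma has_weak_partial_cong_AE:
  assumes \<Omega>: "open \<Omega>" and u: "has_weak_partial \<Omega> i u g" and w: "w \<in> Lp_loc 1 \<Omega>"
    and eq: "AE x in lebesgue_on \<Omega>. u x = w x"
  shows "has_weak_partial \<Omega> i w g"
  unfolding has_weak_partial_def
proof (intro conjI ballI w)
  show "g \<in> Lp_loc 1 \<Omega>"
    using u by (simp add: has_weak_partial_def)
  fix \<phi>
  assume \<phi>: "\<phi> \<in> test_fun \<Omega>"
  have u_Lp: "u \<in> Lp_loc 1 \<Omega>" using u by (simp add: has_weak_partial_def)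
  have "AE x in lebesgue. x \<in> \<Omega> \<longrightarrow> u x = w x"
    using eq \<Omega> by (simp add: AE_restrict_space_iff)
  then have "AE x in lebesgue. indicat_real \<Omega> x *\<^sub>R (w x * partial i \<phi> x) =
      indicat_real \<Omega> x *\<^sub>R (u x * partial i \<phi> x)"
    by eventually_elim (simp add: indicator_def)
  then have "(LINT x:\<Omega>|lebesgue. w x * partial i \<phi> x) = (LINT x:\<Omega>|lebesgue. u x * partial i \<phi> x)"
    unfolding set_lebesgue_integral_def
    using test_fun_integrable(2)[OF \<Omega> w \<phi>, of i] test_fun_integrable(2)[OF \<Omega> u_Lp \<phi>, of i]
    unfolding set_integrable_def
    by (intro integral_cong_AE borel_measurable_integrable)
  then show "(LINT x:\<Omega>|lebesgue. w x * partial i \<phi> x) = - (LINT x:\<Omega>|lebesgue. g x * \<phi> x)"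
    using u \<phi> by (simp add: has_weak_partial_def)
qed

lemma weak_partial_eq_AE:
  assumes "open \<Omega>" "has_weak_partial \<Omega> i u g"
  shows "has_weak_partial \<Omega> i u (weak_partial \<Omega> i u)"
    and "AE x in lebesgue_on \<Omega>. weak_partial \<Omega> i u x = g x"
proof -
  show weak: "has_weak_partial \<Omega> i u (weak_partial \<Omega> i u)"
    unfolding weak_partial_def by (rule someI[of "has_weak_partial \<Omega> i u", OF assms(2)])
  show "AE x in lebesgue_on \<Omega>. weak_partial \<Omega> i u x = g x"
    using assms(1) weak assms(2) by (rule has_weak_partial_unique)
qed

lemma weak_op_minus_const:
  assumes "open \<Omega>"
  shows "weak_op \<Omega> a b c (\<lambda>x. u x - M) x = weak_op \<Omega> a b c u x - c x * M"
  by (simp add: weak_op_def weak_hessian_def weak_gradient_def weak_partial_minus_const[OF assms]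
      right_diff_distrib)

text \<open>
  Nothing relates the representatives chosen for \<open>u\<close> and for \<open>- u\<close> except that weak derivatives
  are unique almost everywhere, so here the equality holds only almost everywhere.
\<close>

lemma weak_op_uminus:
  assumes \<Omega>: "open \<Omega>" and u: "(\<lambda>x. - u x) \<in> W2d_loc \<Omega>"
  shows "AE x in lebesgue_on \<Omega>. weak_op \<Omega> a b c (\<lambda>x. - u x) x = - weak_op \<Omega> a b c u x"
proof -
  define w where "w = (\<lambda>x. - u x)"
  have u_eq: "u = (\<lambda>x. - w x)" by (simp add: w_def)
  let ?W = "weak_partial \<Omega>"
  have w: "has_weak_partial \<Omega> j w (?W j w)" for j
    using u weak_partial_eq_AE(1)[OF \<Omega>] unfolding w_def W2d_loc_def by blast
  have ww: "has_weak_partial \<Omega> i (?W j w) (?W i (?W j w))" for i j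
    using u weak_partial_eq_AE(1)[OF \<Omega>] unfolding w_def W2d_loc_def by blast
  have u1: "has_weak_partial \<Omega> j u (\<lambda>x. - ?W j w x)" for j
    unfolding u_eq using w by (rule has_weak_partial_uminus)
  note D1 = weak_partial_eq_AE[OF \<Omega> u1]
  have "has_weak_partial \<Omega> i (?W j u) (\<lambda>x. - ?W i (?W j w) x)" for i j
  proof (rule has_weak_partial_cong_AE[OF \<Omega> has_weak_partial_uminus[OF ww]])
    show "?W j u \<in> Lp_loc 1 \<Omega>"
      using D1(1) by (simp add: has_weak_partial_def)
    show "AE x in lebesgue_on \<Omega>. - ?W j w x = ?W j u x"
      using D1(2)[of j] by eventually_elim simp
  qed
  note D2 = weak_partial_eq_AE(2)[OF \<Omega> this]
  have "AE x in lebesgue_on \<Omega>. \<forall>j. ?W j u x = - ?W j w x"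
    by (intro eventually_all_finite D1(2))
  moreover have "AE x in lebesgue_on \<Omega>. \<forall>i j. ?W i (?W j u) x = - ?W i (?W j w) x"
    by (intro eventually_all_finite D2)
  ultimately have "AE x in lebesgue_on \<Omega>. weak_op \<Omega> a b c u x = - weak_op \<Omega> a b c w x"
  proof eventually_elim
    case (elim x)
    then have "weak_gradient \<Omega> u x = - weak_gradient \<Omega> w x"
      and "weak_hessian \<Omega> u x = - weak_hessian \<Omega> w x"
      by (simp_all add: weak_gradient_def weak_hessian_def vec_eq_iff)
    then show ?case
      by (simp add: weak_op_def trace_matrix_mult_uminus w_def)
  qed
  then show ?thesis
    by eventually_elim (simp add: w_def)
qed

section \<open>The a priori estimates\<close>

text \<open>
  The difference is \<open>u + M * (- 1)\<close>; this is the point at which the cone has to contain \<open>- 1\<close>.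
\<close>

lemma fun_convex_cone_minus_const:
  assumes "fun_convex_cone \<KK>" "(\<lambda>x. - 1) \<in> \<KK>" "u \<in> \<KK>" "0 \<le> M"
  shows "(\<lambda>x. u x - M) \<in> \<KK>"
proof -
  have add: "(\<lambda>x. f x + g x) \<in> \<KK>" if "f \<in> \<KK>" "g \<in> \<KK>" for f g
    using assms(1) that by (simp add: fun_convex_cone_def)
  have scale: "(\<lambda>x. t * f x) \<in> \<KK>" if "f \<in> \<KK>" "0 \<le> t" for f t
    using assms(1) that by (simp add: fun_convex_cone_def)
  show ?thesis
    using add[OF assms(3) scale[OF assms(2,4)]] by simp
qed

lemma classical_max_principle_operator:
  assumes \<Omega>: "open \<Omega>" and cone: "fun_convex_cone \<KK>" "(\<lambda>x. - 1) \<in> \<KK>"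
    and \<KK>: "\<KK> \<subseteq> C2 \<Omega>" "weak_max_principle_C2 a b c \<Omega> \<Sigma> \<KK>"
  shows "weak_max_principle_operator \<Omega> \<Sigma> \<KK> (classical_op a b c) c (principal \<Omega>)"
proof
  show "\<forall>\<^sub>F x in principal \<Omega>. classical_op a b c (\<lambda>x. - u x) x = - classical_op a b c u x"
    if "(\<lambda>x. - u x) \<in> \<KK>" for u
    using classical_op_uminus[OF \<Omega>] that \<KK>(1) by (auto simp: eventually_principal)
qed (use \<Omega> \<KK>(2) fun_convex_cone_minus_const[OF cone] in
    \<open>auto simp: weak_max_principle_C2_def classical_op_minus_const eventually_principal\<close>)

lemma sobolev_max_principle_operator:
  assumes \<Omega>: "open \<Omega>" and cone: "fun_convex_cone \<KK>" "(\<lambda>x. - 1) \<in> \<KK>"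
    and \<KK>: "\<KK> \<subseteq> W2d_loc \<Omega>" "weak_max_principle_W2d a b c \<Omega> \<Sigma> \<KK>"
  shows "weak_max_principle_operator \<Omega> \<Sigma> \<KK> (weak_op \<Omega> a b c) c (ae_filter (lebesgue_on \<Omega>))"
proof
  show "AE x in lebesgue_on \<Omega>. weak_op \<Omega> a b c (\<lambda>x. - u x) x = - weak_op \<Omega> a b c u x"
    if "(\<lambda>x. - u x) \<in> \<KK>" for u
    using weak_op_uminus[OF \<Omega>] that \<KK>(1) by blast
qed (use \<Omega> \<KK>(2) fun_convex_cone_minus_const[OF cone] in
    \<open>auto simp: weak_max_principle_W2d_def weak_op_minus_const\<close>)

lemma abs_le_sup_norm_closure:
  assumes "x \<in> \<Omega>"
  shows "ennreal \<bar>f x\<bar> \<le> sup_norm \<Omega> (closure \<Omega>) f"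
  unfolding sup_norm_def using assms closure_subset[of \<Omega>] by (intro SUP_upper2[of x]) auto

lemma ess_inf_AE: "AE x in lebesgue_on \<Omega>. ess_inf \<Omega> f \<le> ereal (f x)"
proof -
  have "AE x in lebesgue_on \<Omega>. - ereal (f x) \<le> esssup (lebesgue_on \<Omega>) (\<lambda>x. - ereal (f x))"
    by (rule esssup_AE)
  then show ?thesis
    unfolding ess_inf_def by eventually_elim (rule ereal_uminus_le_reorder[THEN iffD1])
qed

theorem proposition2p2:
  fixes \<Omega> \<Sigma> :: "(real ^ 'n) set"
    and a :: "real ^ 'n \<Rightarrow> real ^ 'n ^ 'n" and b :: "real ^ 'n \<Rightarrow> real ^ 'n"
    and c :: "real ^ 'n \<Rightarrow> real"
    and \<KK> :: "(real ^ 'n \<Rightarrow> real) set" and u v :: "real ^ 'n \<Rightarrow> real"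
  assumes "open \<Omega>"
    and "openin (top_of_set (frontier \<Omega>)) \<Sigma>"
    and "\<And>x. x \<in> \<Omega> \<Longrightarrow> nonneg_definite (a x)"
    and "fun_convex_cone \<KK>" and "(\<lambda>x. 1) \<in> \<KK>" and "(\<lambda>x. - 1) \<in> \<KK>"
    and "u \<in> \<KK>" and "(\<lambda>x. - v x) \<in> \<KK>"
  shows "(\<KK> \<subseteq> C2 \<Omega> \<and> weak_max_principle_C2 a b c \<Omega> \<Sigma> \<KK> \<longrightarrow>
        ((\<forall>x\<in>\<Omega>. c x \<ge> 0) \<and> (\<forall>x\<in>\<Omega>. classical_op a b c u x \<le> 0) \<longrightarrow>
           (\<forall>x\<in>\<Omega>. ereal (u x) \<le> max 0 (SUP y\<in>frontier \<Omega> - \<Sigma>. usc_env \<Omega> u y))) \<and>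
        (\<forall>c0>0. (\<forall>x\<in>\<Omega>. c x \<ge> c0) \<longrightarrow>
           (\<forall>x\<in>\<Omega>. ereal (u x) \<le> max 0 (max (ereal (1 / c0) * (SUP y\<in>\<Omega>. ereal (classical_op a b c u y)))
              (SUP y\<in>frontier \<Omega> - \<Sigma>. usc_env \<Omega> u y)))) \<and>
        ((\<forall>x\<in>\<Omega>. c x \<ge> 0) \<and> (\<forall>x\<in>\<Omega>. classical_op a b c v x \<ge> 0) \<longrightarrow>
           (\<forall>x\<in>\<Omega>. ereal (v x) \<ge> min 0 (INF y\<in>frontier \<Omega> - \<Sigma>. lsc_env \<Omega> v y))) \<and>
        (\<forall>c0>0. (\<forall>x\<in>\<Omega>. c x \<ge> c0) \<longrightarrow>
           (\<forall>x\<in>\<Omega>. ereal (v x) \<ge> min 0 (min (ereal (1 / c0) * (INF y\<in>\<Omega>. ereal (classical_op a b c v y)))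
              (INF y\<in>frontier \<Omega> - \<Sigma>. lsc_env \<Omega> v y)))) \<and>
        ((\<forall>x\<in>\<Omega>. c x \<ge> 0) \<and> (\<forall>x\<in>\<Omega>. classical_op a b c u x = 0) \<and>
           extends_continuously \<Omega> (frontier \<Omega> - closure \<Sigma>) u \<and> (\<lambda>x. - u x) \<in> \<KK> \<longrightarrow>
           sup_norm \<Omega> (closure \<Omega>) u \<le> sup_norm \<Omega> (frontier \<Omega> - \<Sigma>) u) \<and>
        (\<forall>c0>0. (\<forall>x\<in>\<Omega>. c x \<ge> c0) \<and>
           extends_continuously \<Omega> (frontier \<Omega> - closure \<Sigma>) u \<and> (\<lambda>x. - u x) \<in> \<KK> \<longrightarrow>
           sup_norm \<Omega> (closure \<Omega>) u \<le>
             max (ennreal (1 / c0) * sup_norm \<Omega> (closure \<Omega>) (classical_op a b c u))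
               (sup_norm \<Omega> (frontier \<Omega> - \<Sigma>) u))) \<and>
      (\<KK> \<subseteq> W2d_loc \<Omega> \<and> weak_max_principle_W2d a b c \<Omega> \<Sigma> \<KK> \<and>
         a \<in> borel_measurable (lebesgue_on \<Omega>) \<and> b \<in> borel_measurable (lebesgue_on \<Omega>) \<and>
         c \<in> borel_measurable (lebesgue_on \<Omega>) \<longrightarrow>
        ((AE x in lebesgue_on \<Omega>. c x \<ge> 0) \<and> (AE x in lebesgue_on \<Omega>. weak_op \<Omega> a b c u x \<le> 0) \<longrightarrow>
           (\<forall>x\<in>\<Omega>. ereal (u x) \<le> max 0 (SUP y\<in>frontier \<Omega> - \<Sigma>. usc_env \<Omega> u y))) \<and>
        (\<forall>c0>0. (AE x in lebesgue_on \<Omega>. c x \<ge> c0) \<longrightarrow>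
           (\<forall>x\<in>\<Omega>. ereal (u x) \<le> max 0 (max (ereal (1 / c0) * ess_sup \<Omega> (weak_op \<Omega> a b c u))
              (SUP y\<in>frontier \<Omega> - \<Sigma>. usc_env \<Omega> u y)))) \<and>
        ((AE x in lebesgue_on \<Omega>. c x \<ge> 0) \<and> (AE x in lebesgue_on \<Omega>. weak_op \<Omega> a b c v x \<ge> 0) \<longrightarrow>
           (\<forall>x\<in>\<Omega>. ereal (v x) \<ge> min 0 (INF y\<in>frontier \<Omega> - \<Sigma>. lsc_env \<Omega> v y))) \<and>
        (\<forall>c0>0. (AE x in lebesgue_on \<Omega>. c x \<ge> c0) \<longrightarrow>
           (\<forall>x\<in>\<Omega>. ereal (v x) \<ge> min 0 (min (ereal (1 / c0) * ess_inf \<Omega> (weak_op \<Omega> a b c v))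
              (INF y\<in>frontier \<Omega> - \<Sigma>. lsc_env \<Omega> v y)))) \<and>
        ((AE x in lebesgue_on \<Omega>. c x \<ge> 0) \<and> (AE x in lebesgue_on \<Omega>. weak_op \<Omega> a b c u x = 0) \<and>
           extends_continuously \<Omega> (frontier \<Omega> - closure \<Sigma>) u \<and> (\<lambda>x. - u x) \<in> \<KK> \<longrightarrow>
           sup_norm \<Omega> (closure \<Omega>) u \<le> sup_norm \<Omega> (frontier \<Omega> - \<Sigma>) u) \<and>
        (\<forall>c0>0. (AE x in lebesgue_on \<Omega>. c x \<ge> c0) \<and>
           extends_continuously \<Omega> (frontier \<Omega> - closure \<Sigma>) u \<and> (\<lambda>x. - u x) \<in> \<KK> \<longrightarrow>
           sup_norm \<Omega> (closure \<Omega>) u \<le>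
             max (ennreal (1 / c0) * Linf_norm \<Omega> (weak_op \<Omega> a b c u))
               (sup_norm \<Omega> (frontier \<Omega> - \<Sigma>) u)))"
proof (intro conjI impI allI; elim conjE)
  assume "\<KK> \<subseteq> C2 \<Omega>" "weak_max_principle_C2 a b c \<Omega> \<Sigma> \<KK>"
  then interpret C: weak_max_principle_operator \<Omega> \<Sigma> \<KK> "classical_op a b c" c "principal \<Omega>"
    using assms(1,4,6) by (intro classical_max_principle_operator)
  {
    assume "\<forall>x\<in>\<Omega>. c x \<ge> 0" "\<forall>x\<in>\<Omega>. classical_op a b c u x \<le> 0"
    then show "\<forall>x\<in>\<Omega>. ereal (u x) \<le> max 0 (SUP y\<in>frontier \<Omega> - \<Sigma>. usc_env \<Omega> u y)"
      using C.subsolution_le[OF assms(7)] by (simp add: eventually_principal)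
  next
    fix c0 :: real
    assume "0 < c0" "\<forall>x\<in>\<Omega>. c x \<ge> c0"
    then show "\<forall>x\<in>\<Omega>. ereal (u x) \<le> max 0 (max (ereal (1 / c0) * (SUP y\<in>\<Omega>. ereal (classical_op a b c u y)))
          (SUP y\<in>frontier \<Omega> - \<Sigma>. usc_env \<Omega> u y))"
      by (intro C.subsolution_le_pos[OF assms(7)]) (auto simp: eventually_principal intro: SUP_upper)
  next
    assume "\<forall>x\<in>\<Omega>. c x \<ge> 0" "\<forall>x\<in>\<Omega>. classical_op a b c v x \<ge> 0"
    then show "\<forall>x\<in>\<Omega>. ereal (v x) \<ge> min 0 (INF y\<in>frontier \<Omega> - \<Sigma>. lsc_env \<Omega> v y)"
      using C.supersolution_ge[OF assms(8)] by (simp add: eventually_principal)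
  next
    fix c0 :: real
    assume "0 < c0" "\<forall>x\<in>\<Omega>. c x \<ge> c0"
    then show "\<forall>x\<in>\<Omega>. ereal (v x) \<ge> min 0 (min (ereal (1 / c0) * (INF y\<in>\<Omega>. ereal (classical_op a b c v y)))
          (INF y\<in>frontier \<Omega> - \<Sigma>. lsc_env \<Omega> v y))"
      by (intro C.supersolution_ge_pos[OF assms(8)]) (auto simp: eventually_principal intro: INF_lower)
  next
    assume "\<forall>x\<in>\<Omega>. c x \<ge> 0" "\<forall>x\<in>\<Omega>. classical_op a b c u x = 0" "(\<lambda>x. - u x) \<in> \<KK>"
    then show "sup_norm \<Omega> (closure \<Omega>) u \<le> sup_norm \<Omega> (frontier \<Omega> - \<Sigma>) u"
      using C.solution_sup_norm_le[OF assms(7)] by (simp add: eventually_principal)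
  next
    fix c0 :: real
    assume "0 < c0" "\<forall>x\<in>\<Omega>. c x \<ge> c0" "(\<lambda>x. - u x) \<in> \<KK>"
    then show "sup_norm \<Omega> (closure \<Omega>) u \<le>
        max (ennreal (1 / c0) * sup_norm \<Omega> (closure \<Omega>) (classical_op a b c u))
          (sup_norm \<Omega> (frontier \<Omega> - \<Sigma>) u)"
      by (intro C.sup_norm_le_pos[OF assms(7)])
        (simp_all add: eventually_principal abs_le_sup_norm_closure)
  }
next
  assume "\<KK> \<subseteq> W2d_loc \<Omega>" "weak_max_principle_W2d a b c \<Omega> \<Sigma> \<KK>"
  then interpret W: weak_max_principle_operator \<Omega> \<Sigma> \<KK> "weak_op \<Omega> a b c" c
      "ae_filter (lebesgue_on \<Omega>)"
    using assms(1,4,6) by (intro sobolev_max_principle_operator)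
  {
    assume "AE x in lebesgue_on \<Omega>. c x \<ge> 0" "AE x in lebesgue_on \<Omega>. weak_op \<Omega> a b c u x \<le> 0"
    then show "\<forall>x\<in>\<Omega>. ereal (u x) \<le> max 0 (SUP y\<in>frontier \<Omega> - \<Sigma>. usc_env \<Omega> u y)"
      by (rule W.subsolution_le[OF assms(7)])
  next
    fix c0 :: real
    assume "0 < c0" "AE x in lebesgue_on \<Omega>. c x \<ge> c0"
    then show "\<forall>x\<in>\<Omega>. ereal (u x) \<le> max 0 (max (ereal (1 / c0) * ess_sup \<Omega> (weak_op \<Omega> a b c u))
          (SUP y\<in>frontier \<Omega> - \<Sigma>. usc_env \<Omega> u y))"
      unfolding ess_sup_def by (rule W.subsolution_le_pos[OF assms(7) _ _ esssup_AE])
  next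
    assume "AE x in lebesgue_on \<Omega>. c x \<ge> 0" "AE x in lebesgue_on \<Omega>. weak_op \<Omega> a b c v x \<ge> 0"
    then show "\<forall>x\<in>\<Omega>. ereal (v x) \<ge> min 0 (INF y\<in>frontier \<Omega> - \<Sigma>. lsc_env \<Omega> v y)"
      by (rule W.supersolution_ge[OF assms(8)])
  next
    fix c0 :: real
    assume "0 < c0" "AE x in lebesgue_on \<Omega>. c x \<ge> c0"
    then show "\<forall>x\<in>\<Omega>. ereal (v x) \<ge> min 0 (min (ereal (1 / c0) * ess_inf \<Omega> (weak_op \<Omega> a b c v))
          (INF y\<in>frontier \<Omega> - \<Sigma>. lsc_env \<Omega> v y))"
      by (rule W.supersolution_ge_pos[OF assms(8) _ _ ess_inf_AE])
  next
    assume "(\<lambda>x. - u x) \<in> \<KK>" "AE x in lebesgue_on \<Omega>. c x \<ge> 0"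
      "AE x in lebesgue_on \<Omega>. weak_op \<Omega> a b c u x = 0"
    then show "sup_norm \<Omega> (closure \<Omega>) u \<le> sup_norm \<Omega> (frontier \<Omega> - \<Sigma>) u"
      by (rule W.solution_sup_norm_le[OF assms(7)])
  next
    fix c0 :: real
    assume "(\<lambda>x. - u x) \<in> \<KK>" "0 < c0" "AE x in lebesgue_on \<Omega>. c x \<ge> c0"
    then show "sup_norm \<Omega> (closure \<Omega>) u \<le>
        max (ennreal (1 / c0) * Linf_norm \<Omega> (weak_op \<Omega> a b c u))
          (sup_norm \<Omega> (frontier \<Omega> - \<Sigma>) u)"
      unfolding Linf_norm_def by (rule W.sup_norm_le_pos[OF assms(7) _ _ _ esssup_AE])
  }
qed

end
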